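(* Let $G$ and $\Gamma$ be any groups and $n\ge1$. Then there is a bijective correspondence between the set of isomorphism classes of $\Gamma$-irreducible $G$-principal bundles over $\Gamma$-sets of order $n$ and the set $$\coprod_{[H],\ |\Gamma/H|=n}\mathrm{Hom}(H,G)/(N_\Gamma(H)\times G),$$ where $[H]$ runs over the set of conjugacy classes of index $n$ subgroups of $\Gamma$ (one representative $H$ being chosen in each class), $N_\Gamma(H)$ acts on $\mathrm{Hom}(H,G)$ through conjugation on $H$, and $G$ acts by conjugation on the target. The class of $\rho:H\to G$ corresponds to the isomorphism class of the bundle $P_\rho=\Gamma\times_\rho G\to\Gamma/H$.
   Context: A $\Gamma$-equivariant $G$-principal bundle over a (left, discrete) $\Gamma$-set $Z$ is a set $P$ with a free right $G$-action, a map $\pi:P\to Z$ whose fibres are exactly the $G$-orbits (each nonempty), and a left $\Gamma$-action on $P$ commuting with the $G$-action and inducing the given $\Gamma$-action on $Z$. An isomorphism is a bijection of total spaces commuting with both the $\Gamma$- and $G$-actions (the induced map of bases is an isomorphism of $\Gamma$-sets, not required to be an identity). The bundle is called $\Gamma$-irreducible if $Z$ is a transitive $\Gamma$-set. For a subgroup $H\subset\Gamma$ and a homomorphism $\rho:H\to G$, $P_\rho=\Gamma\times_\rho G=(\Gamma\times G)/\bigl((u,g)\sim(uh,\rho(h)^{-1}g),\ h\in H\bigr)$ with left $\Gamma$-action $\gamma[u,g]=[\gamma u,g]$, right $G$-action $[u,g]k=[u,gk]$ and projection $[u,g]\mapsto uH$. $N_\Gamma(H)$ is the normalizer of $H$ in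 $\Gamma$. *)

theory Defs
  imports "HOL-Algebra.Group_Action" "HOL-Algebra.Left_Coset"
begin

section \<open>Equivariant principal bundles over discrete sets\<close>

text \<open>
  The total space and the base are carrier sets inside arbitrary types. A right action is written
  as a curried function taking the point first.
\<close>

record ('a, 'b, 'p, 'z) principal_bundle =
  total_space :: "'p set"
  base_space :: "'z set"
  bundle_proj :: "'p \<Rightarrow> 'z"
  left_act :: "'a \<Rightarrow> 'p \<Rightarrow> 'p"
  right_act :: "'p \<Rightarrow> 'b \<Rightarrow> 'p"
  base_act :: "'a \<Rightarrow> 'z \<Rightarrow> 'z"

locale equivariant_principal_bundle =
  base: group_action \<Gamma> "base_space B" "base_act B" +
  total: group_action \<Gamma> "total_space B" "left_act B" +
  G: group G
  for \<Gamma> :: "('a, 'm) monoid_scheme" and G :: "('b, 'k) monoid_scheme"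
    and B :: "('a, 'b, 'p, 'z) principal_bundle" +
  assumes right_closed:
      "\<lbrakk>p \<in> total_space B; k \<in> carrier G\<rbrakk> \<Longrightarrow> right_act B p k \<in> total_space B"
    and right_one: "p \<in> total_space B \<Longrightarrow> right_act B p \<one>\<^bsub>G\<^esub> = p"
    and right_mult:
      "\<lbrakk>p \<in> total_space B; k \<in> carrier G; l \<in> carrier G\<rbrakk>
        \<Longrightarrow> right_act B p (k \<otimes>\<^bsub>G\<^esub> l) = right_act B (right_act B p k) l"
    and right_free:
      "\<lbrakk>p \<in> total_space B; k \<in> carrier G; right_act B p k = p\<rbrakk> \<Longrightarrow> k = \<one>\<^bsub>G\<^esub>"
    and proj_closed: "p \<in> total_space B \<Longrightarrow> bundle_proj B p \<in> base_space B"
    and fibres_eq_orbits: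
      "(\<lambda>z. {p \<in> total_space B. bundle_proj B p = z}) ` base_space B
        = (\<lambda>p. right_act B p ` carrier G) ` total_space B"
    and acts_commute:
      "\<lbrakk>\<gamma> \<in> carrier \<Gamma>; p \<in> total_space B; k \<in> carrier G\<rbrakk>
        \<Longrightarrow> left_act B \<gamma> (right_act B p k) = right_act B (left_act B \<gamma> p) k"
    and proj_equivariant:
      "\<lbrakk>\<gamma> \<in> carrier \<Gamma>; p \<in> total_space B\<rbrakk>
        \<Longrightarrow> bundle_proj B (left_act B \<gamma> p) = base_act B \<gamma> (bundle_proj B p)"

text \<open>
  The two bundles may live in different types. An equivariant bijection of the total spaces
  automatically induces an isomorphism of the base sets, so nothing is required of the latter.
\<close>

definition bundle_isomorphic ::
    "('a, 'm) monoid_scheme \<Rightarrow> ('b, 'k) monoid_scheme \<Rightarrow>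
      ('a, 'b, 'p, 'z) principal_bundle \<Rightarrow> ('a, 'b, 'q, 'y) principal_bundle \<Rightarrow> bool"
  where "bundle_isomorphic \<Gamma> G B B' \<longleftrightarrow>
    (\<exists>f. bij_betw f (total_space B) (total_space B') \<and>
      (\<forall>\<gamma>\<in>carrier \<Gamma>. \<forall>p\<in>total_space B. f (left_act B \<gamma> p) = left_act B' \<gamma> (f p)) \<and>
      (\<forall>k\<in>carrier G. \<forall>p\<in>total_space B. f (right_act B p k) = right_act B' (f p) k))"

definition irreducible_bundle ::
    "('a, 'm) monoid_scheme \<Rightarrow> ('b, 'k) monoid_scheme \<Rightarrow> ('a, 'b, 'p, 'z) principal_bundle \<Rightarrow> bool"
  where "irreducible_bundle \<Gamma> G B \<longleftrightarrow>
    equivariant_principal_bundle \<Gamma> G B \<and>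
    base_space B \<noteq> {} \<and> transitive_action \<Gamma> (base_space B) (base_act B)"

definition irreducible_bundles ::
    "('a, 'm) monoid_scheme \<Rightarrow> ('b, 'k) monoid_scheme \<Rightarrow> nat \<Rightarrow> ('a, 'b, 'p, 'z) principal_bundle set"
  where "irreducible_bundles \<Gamma> G n =
    {B. irreducible_bundle \<Gamma> G B \<and> finite (base_space B) \<and> card (base_space B) = n}"

definition bundle_iso_rel ::
    "('a, 'm) monoid_scheme \<Rightarrow> ('b, 'k) monoid_scheme \<Rightarrow> nat \<Rightarrow> ('a, 'b, 'p, 'z) principal_bundle rel"
  where "bundle_iso_rel \<Gamma> G n =
    {(B, B'). B \<in> irreducible_bundles \<Gamma> G n \<and> B' \<in> irreducible_bundles \<Gamma> G n \<and>
      bundle_isomorphic \<Gamma> G B B'}"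

section \<open>The bundle associated with a homomorphism\<close>

definition assoc_rel ::
    "('a, 'm) monoid_scheme \<Rightarrow> ('b, 'k) monoid_scheme \<Rightarrow> 'a set \<Rightarrow> ('a \<Rightarrow> 'b) \<Rightarrow> ('a \<times> 'b) rel"
  where "assoc_rel \<Gamma> G H \<rho> =
    {((u, g), (u \<otimes>\<^bsub>\<Gamma>\<^esub> h, inv\<^bsub>G\<^esub> (\<rho> h) \<otimes>\<^bsub>G\<^esub> g)) | u g h.
      u \<in> carrier \<Gamma> \<and> g \<in> carrier G \<and> h \<in> H}"

definition assoc_total ::
    "('a, 'm) monoid_scheme \<Rightarrow> ('b, 'k) monoid_scheme \<Rightarrow> 'a set \<Rightarrow> ('a \<Rightarrow> 'b) \<Rightarrow> ('a \<times> 'b) set set"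
  where "assoc_total \<Gamma> G H \<rho> = (carrier \<Gamma> \<times> carrier G) // assoc_rel \<Gamma> G H \<rho>"

text \<open>
  Functions on equivalence classes are given by the union of their (equal) values on all
  representatives. Restriction is needed since \<^const>\<open>group_action\<close> asks for extensional maps.
\<close>

definition assoc_bundle ::
    "('a, 'm) monoid_scheme \<Rightarrow> ('b, 'k) monoid_scheme \<Rightarrow> 'a set \<Rightarrow> ('a \<Rightarrow> 'b) \<Rightarrow>
      ('a, 'b, ('a \<times> 'b) set, 'a set) principal_bundle"
  where "assoc_bundle \<Gamma> G H \<rho> =
    \<lparr> total_space = assoc_total \<Gamma> G H \<rho>,
      base_space = lcosets\<^bsub>\<Gamma>\<^esub> H,
      bundle_proj = (\<lambda>p. \<Union>(u, g)\<in>p. u <#\<^bsub>\<Gamma>\<^esub> H),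
      left_act = (\<lambda>\<gamma>. \<lambda>p\<in>assoc_total \<Gamma> G H \<rho>.
        \<Union>(u, g)\<in>p. assoc_rel \<Gamma> G H \<rho> `` {(\<gamma> \<otimes>\<^bsub>\<Gamma>\<^esub> u, g)}),
      right_act = (\<lambda>p k. \<Union>(u, g)\<in>p. assoc_rel \<Gamma> G H \<rho> `` {(u, g \<otimes>\<^bsub>G\<^esub> k)}),
      base_act = (\<lambda>\<gamma>. \<lambda>C\<in>lcosets\<^bsub>\<Gamma>\<^esub> H. \<gamma> <#\<^bsub>\<Gamma>\<^esub> C) \<rparr>"

section \<open>Homomorphisms up to conjugation\<close>

definition index_subgroups :: "('a, 'm) monoid_scheme \<Rightarrow> nat \<Rightarrow> 'a set set"
  where "index_subgroups \<Gamma> n =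
    {H. subgroup H \<Gamma> \<and> finite (lcosets\<^bsub>\<Gamma>\<^esub> H) \<and> card (lcosets\<^bsub>\<Gamma>\<^esub> H) = n}"

definition conjugacy_representatives :: "('a, 'm) monoid_scheme \<Rightarrow> 'a set set \<Rightarrow> 'a set set \<Rightarrow> bool"
  where "conjugacy_representatives \<Gamma> S R \<longleftrightarrow>
    R \<subseteq> S \<and>
    (\<forall>K\<in>S. \<exists>!H. H \<in> R \<and> (\<exists>\<gamma>\<in>carrier \<Gamma>. H = \<gamma> <#\<^bsub>\<Gamma>\<^esub> K #>\<^bsub>\<Gamma>\<^esub> inv\<^bsub>\<Gamma>\<^esub> \<gamma>))"

text \<open>Extensionality makes equality of homomorphisms mean equality on \<open>H\<close>.\<close>

definition Hom ::
    "('a, 'm) monoid_scheme \<Rightarrow> ('b, 'k) monoid_scheme \<Rightarrow> 'a set \<Rightarrow> ('a \<Rightarrow> 'b) set"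
  where "Hom \<Gamma> G H = hom (\<Gamma>\<lparr>carrier := H\<rparr>) G \<inter> extensional H"

definition Hom_group ::
    "('a, 'm) monoid_scheme \<Rightarrow> ('b, 'k) monoid_scheme \<Rightarrow> 'a set \<Rightarrow> ('a \<times> 'b) monoid"
  where "Hom_group \<Gamma> G H = \<Gamma>\<lparr>carrier := normalizer \<Gamma> H\<rparr> \<times>\<times> G"

definition Hom_act ::
    "('a, 'm) monoid_scheme \<Rightarrow> ('b, 'k) monoid_scheme \<Rightarrow> 'a set \<Rightarrow>
      'a \<times> 'b \<Rightarrow> ('a \<Rightarrow> 'b) \<Rightarrow> ('a \<Rightarrow> 'b)"
  where "Hom_act \<Gamma> G H = (\<lambda>(u, g). \<lambda>\<rho>\<in>Hom \<Gamma> G H. \<lambda>h\<in>H.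
    g \<otimes>\<^bsub>G\<^esub> \<rho> (inv\<^bsub>\<Gamma>\<^esub> u \<otimes>\<^bsub>\<Gamma>\<^esub> h \<otimes>\<^bsub>\<Gamma>\<^esub> u) \<otimes>\<^bsub>G\<^esub> inv\<^bsub>G\<^esub> g)"

definition Hom_classes ::
    "('a, 'm) monoid_scheme \<Rightarrow> ('b, 'k) monoid_scheme \<Rightarrow> 'a set \<Rightarrow> ('a \<Rightarrow> 'b) set set"
  where "Hom_classes \<Gamma> G H = orbits (Hom_group \<Gamma> G H) (Hom \<Gamma> G H) (Hom_act \<Gamma> G H)"

end

theory Submission
  imports Defs
begin

text \<open>
  A bundle is recovered from what happens at a single point. Fix a point \<open>p\<close> of the total space
  and let \<open>H\<close> be the stabilizer of its image in the base. For \<open>h \<in> H\<close> the point \<open>h p\<close> lies in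
  the same fibre as \<open>p\<close>, so \<open>h p = p \<rho>(h)\<close> for a unique \<open>\<rho>(h)\<close>, because \<open>G\<close> acts simply
  transitively on the fibre; as the two actions commute, \<open>\<rho>\<close> is a homomorphism. The pair
  \<open>(H, \<rho>)\<close> is the isotropy representation at \<open>p\<close>. Three observations turn this into a
  classification.

  \<^item> If the base is transitive, every point has the form \<open>(u p) k\<close>, and whether
    \<open>(u p) k = (v p) l\<close> can be read off from \<open>(H, \<rho>)\<close> alone (\<open>translate_eq_iff\<close>). Two
    irreducible bundles with points of the same isotropy representation are therefore isomorphic
    via \<open>(u p) k \<mapsto> (u p') k\<close> (\<open>bundle_isomorphic_if_same_isotropy_rep\<close>).

  \<^item> Moving the base point from \<open>p\<close> to \<open>(u p) g\<^sup>-\<^sup>1\<close> replaces \<open>(H, \<rho>)\<close> by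
    \<open>(u H u\<^sup>-\<^sup>1, h \<mapsto> g \<rho>(u\<^sup>-\<^sup>1 h u) g\<^sup>-\<^sup>1)\<close> (\<open>isotropy_rep_translate\<close>). Since isomorphisms
    preserve isotropy representations, isomorphism of irreducible bundles is exactly conjugacy of
    pairs (\<open>bundle_isomorphic_iff_conjugate_isotropy_rep\<close>).

  \<^item> Every pair \<open>(H, \<rho>)\<close> occurs, namely at the class of \<open>(1, 1)\<close> in the associated bundle
    (\<open>assoc_isotropy_rep\<close>).

  Hence isomorphism classes are conjugacy classes of pairs. Choosing the subgroup among the
  representatives \<open>R\<close> leaves only the conjugations by elements \<open>u\<close> of the normalizer and \<open>g\<close> of \<open>G\<close>,
  so that what remains for a given \<open>H\<close> is \<open>Hom(H, G)\<close> modulo these. The index of \<open>H\<close> is the size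
  of the base by the orbit-stabilizer correspondence.
\<close>

section \<open>Group actions and left cosets\<close>

lemma (in group) group_actionI:
  assumes ext: "\<And>g. g \<in> carrier G \<Longrightarrow> \<phi> g \<in> extensional E"
    and closed: "\<And>g x. \<lbrakk>g \<in> carrier G; x \<in> E\<rbrakk> \<Longrightarrow> \<phi> g x \<in> E"
    and one: "\<And>x. x \<in> E \<Longrightarrow> \<phi> \<one> x = x"
    and mult: "\<And>g h x. \<lbrakk>g \<in> carrier G; h \<in> carrier G; x \<in> E\<rbrakk> \<Longrightarrow> \<phi> (g \<otimes> h) x = \<phi> g (\<phi> h x)"
  shows "group_action G E \<phi>"
proof -
  have bij: "\<phi> g \<in> Bij E" if g: "g \<in> carrier G" for g
  proof -
    have "bij_betw (\<phi> g) E E"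
    proof (rule bij_betw_byWitness[where f' = "\<phi> (inv g)"])
      show "\<forall>x\<in>E. \<phi> (inv g) (\<phi> g x) = x" "\<forall>x\<in>E. \<phi> g (\<phi> (inv g) x) = x"
        using g by (simp_all add: mult[symmetric] one)
    qed (use g closed in auto)
    then show ?thesis
      using ext[OF g] by (simp add: Bij_def)
  qed
  have "\<phi> (g \<otimes> h) = compose E (\<phi> g) (\<phi> h)" if "g \<in> carrier G" "h \<in> carrier G" for g h
    using that by (intro extensionalityI[of _ E]) (auto simp: ext mult compose_eq)
  then have "\<phi> \<in> hom G (BijGroup E)"
    using bij by (simp add: hom_def BijGroup_def)
  then show ?thesis
    by (intro group_action.intro group_hom.intro group_hom_axioms.intro group_BijGroup is_group)
qed

lemma (in group) mem_conjugate_iff: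
  assumes "H \<subseteq> carrier G" "u \<in> carrier G" "x \<in> carrier G"
  shows "x \<in> u <# H #> inv u \<longleftrightarrow> inv u \<otimes> x \<otimes> u \<in> H"
proof
  assume "x \<in> u <# H #> inv u"
  then obtain h where h: "h \<in> H" "x = u \<otimes> h \<otimes> inv u"
    by (auto simp: l_coset_def r_coset_def)
  moreover have "h \<in> carrier G"
    using h assms by auto
  ultimately show "inv u \<otimes> x \<otimes> u \<in> H"
    using assms by (simp add: m_assoc) (simp add: m_assoc[symmetric])
next
  assume *: "inv u \<otimes> x \<otimes> u \<in> H"
  have "x = u \<otimes> (inv u \<otimes> x \<otimes> u) \<otimes> inv u"
    using assms by (simp add: m_assoc) (simp add: m_assoc[symmetric])
  then show "x \<in> u <# H #> inv u"
    using * unfolding l_coset_def r_coset_def by blast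
qed

lemma (in group) conjugate_subset:
  assumes "H \<subseteq> carrier G" "u \<in> carrier G"
  shows "u <# H #> inv u \<subseteq> carrier G"
  using assms by (auto simp: l_coset_def r_coset_def)

lemma (in group) mem_normalizer_iff:
  assumes "H \<subseteq> carrier G"
  shows "u \<in> normalizer G H \<longleftrightarrow> u \<in> carrier G \<and> u <# H #> inv u = H"
  using assms by (simp add: normalizer_def stabilizer_def)

lemma (in group) l_coset_eq_iff:
  assumes H: "subgroup H G" and u: "u \<in> carrier G" and v: "v \<in> carrier G"
  shows "u <# H = v <# H \<longleftrightarrow> inv v \<otimes> u \<in> H"
proof
  assume "u <# H = v <# H"
  then have "u \<in> v <# H"
    using lcos_self[OF u H] by simp
  then show "inv v \<otimes> u \<in> H"
    using subgroup.lcos_module_imp[OF H is_group v] by simp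
next
  assume "inv v \<otimes> u \<in> H"
  then have "u = v \<otimes> (inv v \<otimes> u)" "inv v \<otimes> u \<in> H"
    using u v by (simp_all add: m_assoc[symmetric])
  then have "u \<in> v <# H"
    unfolding l_coset_def by blast
  then show "u <# H = v <# H"
    using l_repr_independence[OF _ v H] by simp
qed

text \<open>
  The orbit-stabilizer correspondence, as a bijection rather than a count, so that it also covers
  infinite groups acting on finite sets. A point corresponds to the set of group elements that move
  \<open>z\<close> to it.
\<close>

lemma (in transitive_action) bij_betw_lcosets_stabilizer:
  assumes z: "z \<in> E"
  shows "bij_betw (\<lambda>y. {u \<in> carrier G. \<phi> u z = y}) E (lcosets (stabilizer G \<phi> z))"
proof -
  interpret group G
    using group_hom group_hom.axioms(1) by auto
  have coset: "{u \<in> carrier G. \<phi> u z = \<phi> v z} = v <# stabilizer G \<phi> z"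
    if v: "v \<in> carrier G" for v
  proof (intro Set.set_eqI iffI)
    fix u assume "u \<in> {u \<in> carrier G. \<phi> u z = \<phi> v z}"
    then have u: "u \<in> carrier G" "\<phi> u z = \<phi> v z" by auto
    have "\<phi> (inv v \<otimes> u) z = \<phi> (inv v) (\<phi> v z)"
      using u v z by (simp add: composition_rule)
    also have "\<dots> = z"
      using v z orbit_sym_aux by blast
    finally have "inv v \<otimes> u \<in> stabilizer G \<phi> z"
      using u v by (simp add: stabilizer_def)
    moreover have "u = v \<otimes> (inv v \<otimes> u)"
      using u v by (simp add: m_assoc[symmetric])
    ultimately show "u \<in> v <# stabilizer G \<phi> z"
      unfolding l_coset_def by blast
  next
    fix u assume "u \<in> v <# stabilizer G \<phi> z"
    then show "u \<in> {u \<in> carrier G. \<phi> u z = \<phi> v z}"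
      using v z by (auto simp: l_coset_def stabilizer_def composition_rule)
  qed
  have orbit: "\<exists>v\<in>carrier G. \<phi> v z = y" if "y \<in> E" for y
    using unique_orbit[OF z that] .
  show ?thesis
  proof (rule bij_betw_imageI)
    show "inj_on (\<lambda>y. {u \<in> carrier G. \<phi> u z = y}) E"
      using orbit by (intro inj_onI) blast
    have "(\<lambda>y. {u \<in> carrier G. \<phi> u z = y}) ` E
        = (\<lambda>v. {u \<in> carrier G. \<phi> u z = \<phi> v z}) ` carrier G"
      using orbit element_image[OF _ z] by blast
    also have "\<dots> = lcosets (stabilizer G \<phi> z)"
      by (auto simp: LCOSETS_def coset)
    finally show "(\<lambda>y. {u \<in> carrier G. \<phi> u z = y}) ` E = lcosets (stabilizer G \<phi> z)" .
  qed
qed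

section \<open>Isomorphisms of bundles\<close>

lemma bundle_isomorphic_refl: "bundle_isomorphic \<Gamma> G B B"
  unfolding bundle_isomorphic_def by (rule exI[of _ id]) auto

lemma bundle_isomorphic_trans:
  assumes "bundle_isomorphic \<Gamma> G B B'" "bundle_isomorphic \<Gamma> G B' B''"
  shows "bundle_isomorphic \<Gamma> G B B''"
proof -
  obtain f g where
    f: "bij_betw f (total_space B) (total_space B')"
      "\<forall>\<gamma>\<in>carrier \<Gamma>. \<forall>p\<in>total_space B. f (left_act B \<gamma> p) = left_act B' \<gamma> (f p)"
      "\<forall>k\<in>carrier G. \<forall>p\<in>total_space B. f (right_act B p k) = right_act B' (f p) k" and
    g: "bij_betw g (total_space B') (total_space B'')"
      "\<forall>\<gamma>\<in>carrier \<Gamma>. \<forall>p\<in>total_space B'. g (left_act B' \<gamma> p) = left_act B'' \<gamma> (g p)"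
      "\<forall>k\<in>carrier G. \<forall>p\<in>total_space B'. g (right_act B' p k) = right_act B'' (g p) k"
    using assms unfolding bundle_isomorphic_def by blast
  show ?thesis
    unfolding bundle_isomorphic_def
    using bij_betw_trans[OF f(1) g(1)] f(2,3) g(2,3) bij_betwE[OF f(1)]
    by (intro exI[of _ "g \<circ> f"]) simp
qed

section \<open>The isotropy representation at a point\<close>

text \<open>
  The stabilizer of the projection of \<open>p\<close> is described through the total space only. Invariance
  under isomorphisms, which are maps of total spaces, is then immediate. Extensionality makes the
  pair \<open>(H, \<rho>)\<close> unique.
\<close>

definition isotropy_rep ::
    "('a, 'm) monoid_scheme \<Rightarrow> ('b, 'k) monoid_scheme \<Rightarrow> ('a, 'b, 'p, 'z) principal_bundle \<Rightarrow>
      'p \<Rightarrow> 'a set \<Rightarrow> ('a \<Rightarrow> 'b) \<Rightarrow> bool"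
  where "isotropy_rep \<Gamma> G B p H \<rho> \<longleftrightarrow>
    p \<in> total_space B \<and>
    H = {h \<in> carrier \<Gamma>. \<exists>k\<in>carrier G. left_act B h p = right_act B p k} \<and>
    \<rho> \<in> extensional H \<and>
    (\<forall>h\<in>H. \<rho> h \<in> carrier G \<and> left_act B h p = right_act B p (\<rho> h))"

lemma isotropy_rep_point: "isotropy_rep \<Gamma> G B p H \<rho> \<Longrightarrow> p \<in> total_space B"
  unfolding isotropy_rep_def by blast

sublocale equivariant_principal_bundle \<subseteq> acting: group \<Gamma>
  using total.group_hom by (rule group_hom.axioms(1))

context equivariant_principal_bundle
begin

lemma left_closed: "\<lbrakk>u \<in> carrier \<Gamma>; p \<in> total_space B\<rbrakk> \<Longrightarrow> left_act B u p \<in> total_space B"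
  using total.element_image by blast

lemma left_one: "p \<in> total_space B \<Longrightarrow> left_act B \<one>\<^bsub>\<Gamma>\<^esub> p = p"
  using total.id_eq_one by (metis restrict_apply')

lemma left_inv: 
  "\<lbrakk>u \<in> carrier \<Gamma>; p \<in> total_space B\<rbrakk> \<Longrightarrow> left_act B (inv\<^bsub>\<Gamma>\<^esub> u) (left_act B u p) = p"
  "\<lbrakk>u \<in> carrier \<Gamma>; p \<in> total_space B\<rbrakk> \<Longrightarrow> left_act B u (left_act B (inv\<^bsub>\<Gamma>\<^esub> u) p) = p"
  by (simp_all add: total.composition_rule[symmetric] left_one)

lemma left_cancel:
  assumes "u \<in> carrier \<Gamma>" "p \<in> total_space B" "q \<in> total_space B" "left_act B u p = left_act B u q"
  shows "p = q"
  using assms left_inv(1) by metis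

lemma right_inv: 
  "\<lbrakk>k \<in> carrier G; p \<in> total_space B\<rbrakk> \<Longrightarrow> right_act B (right_act B p k) (inv\<^bsub>G\<^esub> k) = p"
  "\<lbrakk>k \<in> carrier G; p \<in> total_space B\<rbrakk> \<Longrightarrow> right_act B (right_act B p (inv\<^bsub>G\<^esub> k)) k = p"
  by (simp_all add: right_mult[symmetric] right_one)

lemma right_cancel:
  assumes p: "p \<in> total_space B" and k: "k \<in> carrier G" and l: "l \<in> carrier G"
    and eq: "right_act B p k = right_act B p l"
  shows "k = l"
proof -
  have "right_act B p (k \<otimes>\<^bsub>G\<^esub> inv\<^bsub>G\<^esub> l) = right_act B (right_act B p l) (inv\<^bsub>G\<^esub> l)"
    using p k l eq by (simp add: right_mult)
  then have "k \<otimes>\<^bsub>G\<^esub> inv\<^bsub>G\<^esub> l = \<one>\<^bsub>G\<^esub>"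
    using p k l by (intro right_free[of p]) (simp_all add: right_inv)
  then show ?thesis
    using k l G.inv_solve_right[of "\<one>\<^bsub>G\<^esub>" k l] by simp
qed

text \<open>
  The identity between the family of fibres and the family of orbits says nothing about which
  fibre is which orbit, but \<open>p\<close> itself belongs to its orbit, and that decides it.
\<close>

lemma proj_eq_iff:
  assumes p: "p \<in> total_space B" and q: "q \<in> total_space B"
  shows "bundle_proj B q = bundle_proj B p \<longleftrightarrow> (\<exists>k\<in>carrier G. q = right_act B p k)"
proof -
  have "right_act B p ` carrier G
      \<in> (\<lambda>z. {p \<in> total_space B. bundle_proj B p = z}) ` base_space B"
    using fibres_eq_orbits p by auto
  then obtain z where z: "right_act B p ` carrier G = {p \<in> total_space B. bundle_proj B p = z}"
    by auto
  have "p \<in> right_act B p ` carrier G"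
    using right_one[OF p] by force
  then have "bundle_proj B p = z"
    using z by simp
  then show ?thesis
    using z q by blast
qed

lemma isotropy_rep_stabilizer:
  assumes "isotropy_rep \<Gamma> G B p H \<rho>"
  shows "H = stabilizer \<Gamma> (base_act B) (bundle_proj B p)"
proof -
  have p: "p \<in> total_space B"
    and H: "H = {h \<in> carrier \<Gamma>. \<exists>k\<in>carrier G. left_act B h p = right_act B p k}"
    using assms unfolding isotropy_rep_def by blast+
  have "(\<exists>k\<in>carrier G. left_act B h p = right_act B p k)
      \<longleftrightarrow> base_act B h (bundle_proj B p) = bundle_proj B p" if "h \<in> carrier \<Gamma>" for h
    using proj_eq_iff[OF p left_closed[OF that p]] proj_equivariant[OF that p] by simp
  then show ?thesis
    unfolding H stabilizer_def by blast
qed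

lemma isotropy_rep_unique:
  assumes "isotropy_rep \<Gamma> G B p H \<rho>" "isotropy_rep \<Gamma> G B p H' \<rho>'"
  shows "H' = H \<and> \<rho>' = \<rho>"
proof -
  have H: "H' = H"
    using assms unfolding isotropy_rep_def by metis
  moreover have "\<rho>' = \<rho>"
  proof (rule extensionalityI)
    show "\<rho>' h = \<rho> h" if "h \<in> H" for h
      using assms that unfolding H isotropy_rep_def by (intro right_cancel[of p]) metis+
    show "\<rho>' \<in> extensional H" "\<rho> \<in> extensional H"
      using assms unfolding H isotropy_rep_def by blast+
  qed
  ultimately show ?thesis ..
qed

lemma isotropy_rep_exists:
  assumes p: "p \<in> total_space B"
  obtains H \<rho> where "isotropy_rep \<Gamma> G B p H \<rho>"
proof -
  let ?H = "{h \<in> carrier \<Gamma>. \<exists>k\<in>carrier G. left_act B h p = right_act B p k}"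
  have "\<forall>h\<in>?H. \<exists>k. k \<in> carrier G \<and> left_act B h p = right_act B p k"
    by blast
  from bchoice[OF this]
  obtain r where "\<forall>h\<in>?H. r h \<in> carrier G \<and> left_act B h p = right_act B p (r h)" ..
  then have "isotropy_rep \<Gamma> G B p ?H (restrict r ?H)"
    using p unfolding isotropy_rep_def by simp
  then show thesis ..
qed

lemma isotropy_rep_subgroup:
  assumes "isotropy_rep \<Gamma> G B p H \<rho>"
  shows "subgroup H \<Gamma>"
  unfolding isotropy_rep_stabilizer[OF assms]
  by (intro base.stabilizer_subgroup proj_closed isotropy_rep_point[OF assms])

text \<open>
  Both sides of \<open>\<rho>(g h) = \<rho>(g) \<rho>(h)\<close> describe the position of \<open>(g h) p\<close> relative to \<open>p\<close>:
  \<open>g (h p) = g (p \<rho>(h)) = (g p) \<rho>(h) = p \<rho>(g) \<rho>(h)\<close>. The order is preserved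
  because one action is on the left and the other on the right.
\<close>

lemma isotropy_rep_Hom:
  assumes rep: "isotropy_rep \<Gamma> G B p H \<rho>"
  shows "\<rho> \<in> Hom \<Gamma> G H"
proof -
  have p: "p \<in> total_space B" and ext: "\<rho> \<in> extensional H"
    and r: "\<And>h. h \<in> H \<Longrightarrow> \<rho> h \<in> carrier G"
      "\<And>h. h \<in> H \<Longrightarrow> left_act B h p = right_act B p (\<rho> h)"
    using rep unfolding isotropy_rep_def by blast+
  interpret H: subgroup H \<Gamma>
    using rep by (rule isotropy_rep_subgroup)
  have "\<rho> (g \<otimes>\<^bsub>\<Gamma>\<^esub> h) = \<rho> g \<otimes>\<^bsub>G\<^esub> \<rho> h" if g: "g \<in> H" and h: "h \<in> H" for g h
  proof (rule right_cancel[of p])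
    have "right_act B p (\<rho> (g \<otimes>\<^bsub>\<Gamma>\<^esub> h)) = left_act B (g \<otimes>\<^bsub>\<Gamma>\<^esub> h) p"
      using r(2)[OF H.m_closed[OF g h]] by simp
    also have "\<dots> = left_act B g (right_act B p (\<rho> h))"
      using p g h by (simp add: total.composition_rule r(2)[OF h, symmetric])
    also have "\<dots> = right_act B (right_act B p (\<rho> g)) (\<rho> h)"
      using p r g h by (simp add: acts_commute)
    also have "\<dots> = right_act B p (\<rho> g \<otimes>\<^bsub>G\<^esub> \<rho> h)"
      using p r g h by (simp add: right_mult)
    finally show "right_act B p (\<rho> (g \<otimes>\<^bsub>\<Gamma>\<^esub> h)) = right_act B p (\<rho> g \<otimes>\<^bsub>G\<^esub> \<rho> h)" .
  qed (use p r g h in auto)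
  then show ?thesis
    using r ext by (auto simp: Hom_def hom_def)
qed

text \<open>
  This is where the action of normalizer and structure group on homomorphisms comes from. The
  inverse of \<open>g\<close> in the new base point makes conjugation by \<open>g\<close> come out as a left action.
\<close>

lemma isotropy_rep_translate:
  assumes rep: "isotropy_rep \<Gamma> G B p H \<rho>" and u: "u \<in> carrier \<Gamma>" and g: "g \<in> carrier G"
  shows "isotropy_rep \<Gamma> G B (right_act B (left_act B u p) (inv\<^bsub>G\<^esub> g))
    (u <#\<^bsub>\<Gamma>\<^esub> H #>\<^bsub>\<Gamma>\<^esub> inv\<^bsub>\<Gamma>\<^esub> u)
    (\<lambda>h\<in>u <#\<^bsub>\<Gamma>\<^esub> H #>\<^bsub>\<Gamma>\<^esub> inv\<^bsub>\<Gamma>\<^esub> u.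
      g \<otimes>\<^bsub>G\<^esub> \<rho> (inv\<^bsub>\<Gamma>\<^esub> u \<otimes>\<^bsub>\<Gamma>\<^esub> h \<otimes>\<^bsub>\<Gamma>\<^esub> u) \<otimes>\<^bsub>G\<^esub> inv\<^bsub>G\<^esub> g)"
    (is "isotropy_rep \<Gamma> G B ?q ?K ?\<sigma>")
proof -
  have p: "p \<in> total_space B" and HC: "H \<subseteq> carrier \<Gamma>"
    and H: "\<And>h k. \<lbrakk>h \<in> carrier \<Gamma>; k \<in> carrier G; left_act B h p = right_act B p k\<rbrakk> \<Longrightarrow> h \<in> H"
    and r: "\<And>h. h \<in> H \<Longrightarrow> \<rho> h \<in> carrier G"
      "\<And>h. h \<in> H \<Longrightarrow> left_act B h p = right_act B p (\<rho> h)"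
    using rep unfolding isotropy_rep_def by blast+
  define q where "q = ?q"
  have q: "q \<in> total_space B"
    using p u g by (simp add: q_def right_closed left_closed)
  have up: "left_act B u p = right_act B q g"
    using right_inv(2)[OF g left_closed[OF u p]] by (simp add: q_def)
  \<comment> \<open>Applying \<open>x\<close> at the new point amounts to applying its conjugate at the old one.\<close>
  have move: "left_act B x q
      = right_act B (left_act B u (left_act B (inv\<^bsub>\<Gamma>\<^esub> u \<otimes>\<^bsub>\<Gamma>\<^esub> x \<otimes>\<^bsub>\<Gamma>\<^esub> u) p)) (inv\<^bsub>G\<^esub> g)"
    if x: "x \<in> carrier \<Gamma>" for x
  proof -
    have "left_act B x (left_act B u p)
        = left_act B u (left_act B (inv\<^bsub>\<Gamma>\<^esub> u \<otimes>\<^bsub>\<Gamma>\<^esub> x \<otimes>\<^bsub>\<Gamma>\<^esub> u) p)"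
      using x p u by (simp add: total.composition_rule left_closed left_inv)
    then show ?thesis
      using x p u g by (simp only: q_def acts_commute left_closed G.inv_closed)
  qed
  have act: "left_act B x q = right_act B q (?\<sigma> x) \<and> ?\<sigma> x \<in> carrier G" if x: "x \<in> ?K" for x
  proof -
    have xC: "x \<in> carrier \<Gamma>"
      using x acting.conjugate_subset[OF HC u] by blast
    let ?y = "inv\<^bsub>\<Gamma>\<^esub> u \<otimes>\<^bsub>\<Gamma>\<^esub> x \<otimes>\<^bsub>\<Gamma>\<^esub> u"
    have "?y \<in> H"
      using x xC u HC by (simp add: acting.mem_conjugate_iff)
    then have y: "left_act B ?y p = right_act B p (\<rho> ?y)" "\<rho> ?y \<in> carrier G"
      using r by auto
    have "left_act B x q = right_act B (left_act B u (right_act B p (\<rho> ?y))) (inv\<^bsub>G\<^esub> g)"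
      by (simp only: move[OF xC] y(1))
    also have "\<dots> = right_act B (right_act B (left_act B u p) (\<rho> ?y)) (inv\<^bsub>G\<^esub> g)"
      using p u y(2) by (simp only: acts_commute)
    also have "\<dots> = right_act B (right_act B (right_act B q g) (\<rho> ?y)) (inv\<^bsub>G\<^esub> g)"
      by (simp only: up)
    also have "\<dots> = right_act B q (?\<sigma> x)"
      using x q g y(2) by (simp add: right_mult right_closed)
    finally show ?thesis
      using x g y(2) by simp
  qed
  have "x \<in> ?K" if x: "x \<in> carrier \<Gamma>" and k: "k \<in> carrier G"
    and eq: "left_act B x q = right_act B q k" for x k
  proof -
    let ?y = "inv\<^bsub>\<Gamma>\<^esub> u \<otimes>\<^bsub>\<Gamma>\<^esub> x \<otimes>\<^bsub>\<Gamma>\<^esub> u"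
    have y: "?y \<in> carrier \<Gamma>"
      using x u by simp
    have "left_act B u (left_act B ?y p) = right_act B (left_act B x q) g"
      unfolding move[OF x] using y p u g by (simp add: right_inv left_closed)
    also have "\<dots> = right_act B (right_act B q k) g"
      by (simp only: eq)
    also have "\<dots> = right_act B (left_act B u p) (inv\<^bsub>G\<^esub> g \<otimes>\<^bsub>G\<^esub> k \<otimes>\<^bsub>G\<^esub> g)"
      using p u g k by (simp add: q_def right_mult left_closed right_closed)
    also have "\<dots> = left_act B u (right_act B p (inv\<^bsub>G\<^esub> g \<otimes>\<^bsub>G\<^esub> k \<otimes>\<^bsub>G\<^esub> g))"
      using p u g k by (simp add: acts_commute)
    finally have "left_act B ?y p = right_act B p (inv\<^bsub>G\<^esub> g \<otimes>\<^bsub>G\<^esub> k \<otimes>\<^bsub>G\<^esub> g)"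
      using u p y g k by (rule_tac left_cancel[of u]) (simp_all add: left_closed right_closed)
    then have "?y \<in> H"
      by (rule H[OF y, rotated]) (use g k in simp)
    then show ?thesis
      using x u HC by (simp add: acting.mem_conjugate_iff)
  qed
  then have "?K = {h \<in> carrier \<Gamma>. \<exists>k\<in>carrier G. left_act B h q = right_act B q k}"
    using act acting.conjugate_subset[OF HC u] by blast
  moreover have "?\<sigma> \<in> extensional ?K"
    by (rule restrict_extensional)
  ultimately show ?thesis
    using q act unfolding isotropy_rep_def q_def[symmetric] by blast
qed

lemma bundle_isomorphic_sym:
  assumes "bundle_isomorphic \<Gamma> G B B'"
  shows "bundle_isomorphic \<Gamma> G B' B"
proof -
  obtain f where
    f: "bij_betw f (total_space B) (total_space B')"
      "\<forall>\<gamma>\<in>carrier \<Gamma>. \<forall>p\<in>total_space B. f (left_act B \<gamma> p) = left_act B' \<gamma> (f p)"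
      "\<forall>k\<in>carrier G. \<forall>p\<in>total_space B. f (right_act B p k) = right_act B' (f p) k"
    using assms unfolding bundle_isomorphic_def by blast
  let ?g = "the_inv_into (total_space B) f"
  have gf: "?g (f p) = p" if "p \<in> total_space B" for p
    using f(1) that by (simp add: bij_betw_def the_inv_into_f_f)
  have surj: "\<exists>p\<in>total_space B. q = f p" if "q \<in> total_space B'" for q
    using f(1) that by (auto simp: bij_betw_def)
  have "?g (left_act B' \<gamma> q) = left_act B \<gamma> (?g q)"
    if "\<gamma> \<in> carrier \<Gamma>" "q \<in> total_space B'" for \<gamma> q
    using surj[OF that(2)] f(2) that(1) gf left_closed by metis
  moreover have "?g (right_act B' q k) = right_act B (?g q) k"
    if "k \<in> carrier G" "q \<in> total_space B'" for k q
    using surj[OF that(2)] f(3) that(1) gf right_closed by metis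
  ultimately show ?thesis
    unfolding bundle_isomorphic_def using bij_betw_the_inv_into[OF f(1)] by blast
qed

end

text \<open>
  For an isomorphism \<open>f\<close> the point is \<open>f p\<close>: the equations \<open>h p = p k\<close> that define the pair hold
  at \<open>f p\<close> exactly if they hold at \<open>p\<close>, since \<open>f\<close> is injective and equivariant.
\<close>

lemma isotropy_rep_transfer:
  assumes rep: "isotropy_rep \<Gamma> G B p H \<rho>"
    and B: "equivariant_principal_bundle \<Gamma> G B"
    and iso: "bundle_isomorphic \<Gamma> G B B'"
  obtains q where "isotropy_rep \<Gamma> G B' q H \<rho>"
proof -
  interpret equivariant_principal_bundle \<Gamma> G B by fact
  obtain f where
    f: "bij_betw f (total_space B) (total_space B')"
      "\<forall>\<gamma>\<in>carrier \<Gamma>. \<forall>p\<in>total_space B. f (left_act B \<gamma> p) = left_act B' \<gamma> (f p)"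
      "\<forall>k\<in>carrier G. \<forall>p\<in>total_space B. f (right_act B p k) = right_act B' (f p) k"
    using iso unfolding bundle_isomorphic_def by blast
  have p: "p \<in> total_space B"
    using rep by (rule isotropy_rep_point)
  have eq_iff: "left_act B' h (f p) = right_act B' (f p) k \<longleftrightarrow> left_act B h p = right_act B p k"
    if "h \<in> carrier \<Gamma>" "k \<in> carrier G" for h k
    using f p that left_closed[of h p] right_closed[of p k]
    by (metis bij_betw_imp_inj_on inj_on_eq_iff)
  then have "{h \<in> carrier \<Gamma>. \<exists>k\<in>carrier G. left_act B' h (f p) = right_act B' (f p) k}
      = {h \<in> carrier \<Gamma>. \<exists>k\<in>carrier G. left_act B h p = right_act B p k}"
    by blast
  moreover have "left_act B' h (f p) = right_act B' (f p) (\<rho> h)" if "h \<in> H" for h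
    using rep that eq_iff[of h "\<rho> h"] unfolding isotropy_rep_def by blast
  ultimately have "isotropy_rep \<Gamma> G B' (f p) H \<rho>"
    using rep p bij_betwE[OF f(1)] unfolding isotropy_rep_def by metis
  then show thesis ..
qed

context equivariant_principal_bundle
begin

text \<open>
  The right-hand side mentions only \<open>(H, \<rho>)\<close>, not the bundle. It is also the relation
  that defines the associated bundle, compare \<open>mem_assoc_rel_iff\<close> below.
\<close>

lemma translate_eq_iff:
  assumes rep: "isotropy_rep \<Gamma> G B p H \<rho>"
    and u: "u \<in> carrier \<Gamma>" and v: "v \<in> carrier \<Gamma>" and k: "k \<in> carrier G" and l: "l \<in> carrier G"
  shows "right_act B (left_act B u p) k = right_act B (left_act B v p) l
    \<longleftrightarrow> inv\<^bsub>\<Gamma>\<^esub> u \<otimes>\<^bsub>\<Gamma>\<^esub> v \<in> H \<and> k = \<rho> (inv\<^bsub>\<Gamma>\<^esub> u \<otimes>\<^bsub>\<Gamma>\<^esub> v) \<otimes>\<^bsub>G\<^esub> l"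
    (is "?L \<longleftrightarrow> ?R")
proof -
  let ?w = "inv\<^bsub>\<Gamma>\<^esub> u \<otimes>\<^bsub>\<Gamma>\<^esub> v"
  have p: "p \<in> total_space B" 
    and H: "\<And>h k. \<lbrakk>h \<in> carrier \<Gamma>; k \<in> carrier G; left_act B h p = right_act B p k\<rbrakk> \<Longrightarrow> h \<in> H"
    and r: "\<And>h. h \<in> H \<Longrightarrow> \<rho> h \<in> carrier G"
      "\<And>h. h \<in> H \<Longrightarrow> left_act B h p = right_act B p (\<rho> h)"
    using rep unfolding isotropy_rep_def by blast+
  have w: "?w \<in> carrier \<Gamma>"
    using u v by simp
  have vp: "left_act B v p = left_act B u (left_act B ?w p)"
    using u v p by (simp add: total.composition_rule left_closed left_inv)
  show ?thesis
  proof
    assume L: ?L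
    have "left_act B u (right_act B p k) = left_act B u (right_act B (left_act B ?w p) l)"
      using L u p w k l unfolding vp by (simp only: acts_commute left_closed)
    then have "right_act B p k = right_act B (left_act B ?w p) l"
      by (rule left_cancel[OF u _ _, rotated 2]) (use p w k l in \<open>simp_all only: left_closed right_closed\<close>)
    then have "right_act B (right_act B p k) (inv\<^bsub>G\<^esub> l) = left_act B ?w p"
      using right_inv(1)[OF l left_closed[OF w p]] by simp
    then have eq: "left_act B ?w p = right_act B p (k \<otimes>\<^bsub>G\<^esub> inv\<^bsub>G\<^esub> l)"
      using p k l by (simp add: right_mult)
    then have wH: "?w \<in> H"
      by (rule H[OF w, rotated]) (use k l in simp)
    have "\<rho> ?w = k \<otimes>\<^bsub>G\<^esub> inv\<^bsub>G\<^esub> l"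
      by (rule right_cancel[OF p]) (use r(1)[OF wH] k l eq r(2)[OF wH] in simp_all)
    then show ?R
      using wH k l by (simp add: G.m_assoc)
  next
    assume R: ?R
    then have "right_act B (left_act B v p) l = right_act B (left_act B u (right_act B p (\<rho> ?w))) l"
      using r(2) vp by simp
    also have "\<dots> = right_act B (right_act B (left_act B u p) (\<rho> ?w)) l"
      using R u p r(1) by (simp add: acts_commute)
    also have "\<dots> = right_act B (left_act B u p) k"
      using R r(1) l u p by (simp add: right_mult left_closed)
    finally show ?L by simp
  qed
qed

lemma translate_exhaust:
  assumes trans: "transitive_action \<Gamma> (base_space B) (base_act B)"
    and p: "p \<in> total_space B" and q: "q \<in> total_space B"
  obtains u k where "u \<in> carrier \<Gamma>" "k \<in> carrier G" "q = right_act B (left_act B u p) k"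
proof -
  obtain u where u: "u \<in> carrier \<Gamma>" "base_act B u (bundle_proj B p) = bundle_proj B q"
    using transitive_action.unique_orbit[OF trans] p q proj_closed by blast
  then have "bundle_proj B q = bundle_proj B (left_act B u p)"
    using p by (simp add: proj_equivariant)
  then obtain k where "k \<in> carrier G" "q = right_act B (left_act B u p) k"
    using proj_eq_iff[OF left_closed[OF u(1) p] q] by blast
  then show thesis
    using u(1) that by blast
qed

lemma left_translate:
  assumes "\<gamma> \<in> carrier \<Gamma>" "u \<in> carrier \<Gamma>" "k \<in> carrier G" "p \<in> total_space B"
  shows "left_act B \<gamma> (right_act B (left_act B u p) k) = right_act B (left_act B (\<gamma> \<otimes>\<^bsub>\<Gamma>\<^esub> u) p) k"
  using assms by (simp add: acts_commute left_closed total.composition_rule)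

lemma right_translate:
  assumes "l \<in> carrier G" "u \<in> carrier \<Gamma>" "k \<in> carrier G" "p \<in> total_space B"
  shows "right_act B (right_act B (left_act B u p) k) l = right_act B (left_act B u p) (k \<otimes>\<^bsub>G\<^esub> l)"
  using assms by (simp add: right_mult left_closed)

lemma translate_closed:
  assumes "u \<in> carrier \<Gamma>" "k \<in> carrier G" "p \<in> total_space B"
  shows "right_act B (left_act B u p) k \<in> total_space B"
  using assms by (simp add: right_closed left_closed)

end

text \<open>
  The map \<open>(u p) k \<mapsto> (u p') k\<close> is well defined and injective because coincidences among the
  points on either side are governed by the same criterion \<open>translate_eq_iff\<close>; it is defined
  everywhere and onto because both bases are transitive.
\<close>

lemma bundle_isomorphic_if_same_isotropy_rep:
  assumes B: "irreducible_bundle \<Gamma> G B" and B': "irreducible_bundle \<Gamma> G B'"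
    and rep: "isotropy_rep \<Gamma> G B p H \<rho>" and rep': "isotropy_rep \<Gamma> G B' p' H \<rho>"
  shows "bundle_isomorphic \<Gamma> G B B'"
proof -
  interpret B: equivariant_principal_bundle \<Gamma> G B
    using B by (simp add: irreducible_bundle_def)
  interpret B': equivariant_principal_bundle \<Gamma> G B'
    using B' by (simp add: irreducible_bundle_def)
  have p: "p \<in> total_space B" and p': "p' \<in> total_space B'"
    using rep rep' by (auto dest: isotropy_rep_point)
  define m where "m u k = right_act B (left_act B u p) k" for u k
  define m' where "m' u k = right_act B' (left_act B' u p') k" for u k
  have same: "m u k = m v l \<longleftrightarrow> m' u k = m' v l"
    if "u \<in> carrier \<Gamma>" "k \<in> carrier G" "v \<in> carrier \<Gamma>" "l \<in> carrier G" for u k v l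
    unfolding m_def m'_def
    using that B.translate_eq_iff[OF rep] B'.translate_eq_iff[OF rep'] by simp
  have onto: "\<exists>u\<in>carrier \<Gamma>. \<exists>k\<in>carrier G. q = m u k" if "q \<in> total_space B" for q
    using B.translate_exhaust[OF _ p that] B unfolding m_def irreducible_bundle_def by metis
  have onto': "\<exists>u\<in>carrier \<Gamma>. \<exists>k\<in>carrier G. q = m' u k" if "q \<in> total_space B'" for q
    using B'.translate_exhaust[OF _ p' that] B' unfolding m'_def irreducible_bundle_def by metis
  define f where "f q = (THE q'. \<exists>u\<in>carrier \<Gamma>. \<exists>k\<in>carrier G. q = m u k \<and> q' = m' u k)" for q
  have f: "f (m u k) = m' u k" if "u \<in> carrier \<Gamma>" "k \<in> carrier G" for u k
    unfolding f_def
  proof (rule the_equality)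
    show "\<exists>v\<in>carrier \<Gamma>. \<exists>l\<in>carrier G. m u k = m v l \<and> m' u k = m' v l"
      using that by blast
    show "q' = m' u k"
      if "\<exists>v\<in>carrier \<Gamma>. \<exists>l\<in>carrier G. m u k = m v l \<and> q' = m' v l" for q'
      using that same[OF \<open>u \<in> carrier \<Gamma>\<close> \<open>k \<in> carrier G\<close>] by metis
  qed
  have "bij_betw f (total_space B) (total_space B')"
  proof (rule bij_betw_imageI)
    show "inj_on f (total_space B)"
    proof (rule inj_onI)
      fix q r assume q: "q \<in> total_space B" and r: "r \<in> total_space B" and eq: "f q = f r"
      obtain u k where uk: "u \<in> carrier \<Gamma>" "k \<in> carrier G" "q = m u k"
        using onto[OF q] by blast
      obtain v l where vl: "v \<in> carrier \<Gamma>" "l \<in> carrier G" "r = m v l"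
        using onto[OF r] by blast
      show "q = r"
        using eq f[OF uk(1,2)] f[OF vl(1,2)] same[OF uk(1,2) vl(1,2)] uk(3) vl(3) by simp
    qed
    show "f ` total_space B = total_space B'"
    proof (intro equalityI subsetI)
      fix q' assume "q' \<in> f ` total_space B"
      then obtain q where q: "q \<in> total_space B" "q' = f q"
        by blast
      obtain u k where "u \<in> carrier \<Gamma>" "k \<in> carrier G" "q = m u k"
        using onto[OF q(1)] by blast
      with q(2) show "q' \<in> total_space B'"
        using B'.translate_closed[OF _ _ p'] f unfolding m'_def by metis
    next
      fix q assume q: "q \<in> total_space B'"
      obtain u k where "u \<in> carrier \<Gamma>" "k \<in> carrier G" "q = m' u k"
        using onto'[OF q] by blast
      moreover from this have "m u k \<in> total_space B"
        using B.translate_closed[OF _ _ p] unfolding m_def by blast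
      ultimately show "q \<in> f ` total_space B"
        using f by (metis imageI)
    qed
  qed
  moreover have "f (left_act B \<gamma> q) = left_act B' \<gamma> (f q)"
    if g: "\<gamma> \<in> carrier \<Gamma>" and q: "q \<in> total_space B" for \<gamma> q
  proof -
    obtain u k where uk: "u \<in> carrier \<Gamma>" "k \<in> carrier G" "q = m u k"
      using onto[OF q] by blast
    have "left_act B \<gamma> q = m (\<gamma> \<otimes>\<^bsub>\<Gamma>\<^esub> u) k" "left_act B' \<gamma> (m' u k) = m' (\<gamma> \<otimes>\<^bsub>\<Gamma>\<^esub> u) k"
      using uk g p p' by (simp_all add: m_def m'_def B.left_translate B'.left_translate)
    then show ?thesis
      using uk g f by simp
  qed
  moreover have "f (right_act B q l) = right_act B' (f q) l"
    if l: "l \<in> carrier G" and q: "q \<in> total_space B" for l q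
  proof -
    obtain u k where uk: "u \<in> carrier \<Gamma>" "k \<in> carrier G" "q = m u k"
      using onto[OF q] by blast
    have "right_act B q l = m u (k \<otimes>\<^bsub>G\<^esub> l)" "right_act B' (m' u k) l = m' u (k \<otimes>\<^bsub>G\<^esub> l)"
      using uk l p p' by (simp_all add: m_def m'_def B.right_translate B'.right_translate)
    then show ?thesis
      using uk l f by simp
  qed
  ultimately show ?thesis
    unfolding bundle_isomorphic_def by blast
qed

text \<open>
  In one direction, an isomorphism carries \<open>p\<close> to a point of \<open>B'\<close> that differs from \<open>p'\<close> by
  a translation. In the other, a suitable translate of \<open>p\<close> has the same isotropy representation
  as \<open>p'\<close>.
\<close>

theorem bundle_isomorphic_iff_conjugate_isotropy_rep:
  assumes B: "irreducible_bundle \<Gamma> G B" and B': "irreducible_bundle \<Gamma> G B'"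
    and rep: "isotropy_rep \<Gamma> G B p H \<rho>" and rep': "isotropy_rep \<Gamma> G B' p' K \<sigma>"
  shows "bundle_isomorphic \<Gamma> G B B' \<longleftrightarrow>
    (\<exists>u\<in>carrier \<Gamma>. \<exists>g\<in>carrier G. K = u <#\<^bsub>\<Gamma>\<^esub> H #>\<^bsub>\<Gamma>\<^esub> inv\<^bsub>\<Gamma>\<^esub> u \<and>
      \<sigma> = (\<lambda>h\<in>K. g \<otimes>\<^bsub>G\<^esub> \<rho> (inv\<^bsub>\<Gamma>\<^esub> u \<otimes>\<^bsub>\<Gamma>\<^esub> h \<otimes>\<^bsub>\<Gamma>\<^esub> u) \<otimes>\<^bsub>G\<^esub> inv\<^bsub>G\<^esub> g))"
    (is "_ \<longleftrightarrow> ?conj")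
proof -
  interpret B: equivariant_principal_bundle \<Gamma> G B
    using B by (simp add: irreducible_bundle_def)
  interpret B': equivariant_principal_bundle \<Gamma> G B'
    using B' by (simp add: irreducible_bundle_def)
  show ?thesis
  proof
    assume "bundle_isomorphic \<Gamma> G B B'"
    then obtain q where q: "isotropy_rep \<Gamma> G B' q H \<rho>"
      using isotropy_rep_transfer[OF rep B.equivariant_principal_bundle_axioms] by blast
    obtain u k where u: "u \<in> carrier \<Gamma>" and k: "k \<in> carrier G"
      and p': "p' = right_act B' (left_act B' u q) k"
    proof -
      have "transitive_action \<Gamma> (base_space B') (base_act B')"
        using B' by (simp add: irreducible_bundle_def)
      from B'.translate_exhaust[OF this isotropy_rep_point[OF q] isotropy_rep_point[OF rep']]
      show thesis
        using that by blast
    qed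
    have "p' = right_act B' (left_act B' u q) (inv\<^bsub>G\<^esub> (inv\<^bsub>G\<^esub> k))"
      using p' k by simp
    then show ?conj
      using B'.isotropy_rep_unique[OF B'.isotropy_rep_translate[OF q u B.G.inv_closed[OF k]]]
        rep' u B.G.inv_closed[OF k] by blast
  next
    assume ?conj
    then obtain u g where "u \<in> carrier \<Gamma>" "g \<in> carrier G" "K = u <#\<^bsub>\<Gamma>\<^esub> H #>\<^bsub>\<Gamma>\<^esub> inv\<^bsub>\<Gamma>\<^esub> u"
      "\<sigma> = (\<lambda>h\<in>K. g \<otimes>\<^bsub>G\<^esub> \<rho> (inv\<^bsub>\<Gamma>\<^esub> u \<otimes>\<^bsub>\<Gamma>\<^esub> h \<otimes>\<^bsub>\<Gamma>\<^esub> u) \<otimes>\<^bsub>G\<^esub> inv\<^bsub>G\<^esub> g)"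
      by blast
    then have "isotropy_rep \<Gamma> G B (right_act B (left_act B u p) (inv\<^bsub>G\<^esub> g)) K \<sigma>"
      using B.isotropy_rep_translate[OF rep] by blast
    then show "bundle_isomorphic \<Gamma> G B B'"
      using bundle_isomorphic_if_same_isotropy_rep[OF B B' _ rep'] by blast
  qed
qed

section \<open>The associated bundle\<close>

locale subgroup_hom =
  \<Gamma>: group \<Gamma> + G: group G + H: subgroup H \<Gamma>
  for \<Gamma> :: "('a, 'm) monoid_scheme" and G :: "('b, 'k) monoid_scheme" and H :: "'a set" +
  fixes \<rho> :: "'a \<Rightarrow> 'b"
  assumes Hom: "\<rho> \<in> Hom \<Gamma> G H"
begin

lemma rho_closed: "h \<in> H \<Longrightarrow> \<rho> h \<in> carrier G"
  using Hom by (auto simp: Hom_def hom_def)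

lemma rho_mult: "\<lbrakk>g \<in> H; h \<in> H\<rbrakk> \<Longrightarrow> \<rho> (g \<otimes>\<^bsub>\<Gamma>\<^esub> h) = \<rho> g \<otimes>\<^bsub>G\<^esub> \<rho> h"
  using Hom by (auto simp: Hom_def hom_def)

lemma rho_one: "\<rho> \<one>\<^bsub>\<Gamma>\<^esub> = \<one>\<^bsub>G\<^esub>"
  using rho_mult[of "\<one>\<^bsub>\<Gamma>\<^esub>" "\<one>\<^bsub>\<Gamma>\<^esub>"] rho_closed[OF H.one_closed] by simp

lemma rho_inv: "h \<in> H \<Longrightarrow> \<rho> (inv\<^bsub>\<Gamma>\<^esub> h) = inv\<^bsub>G\<^esub> (\<rho> h)"
  using rho_mult[of "inv\<^bsub>\<Gamma>\<^esub> h" h] rho_one rho_closed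
  by (intro G.inv_equality[symmetric]) simp_all

text \<open>
  Solving for \<open>h = u\<^sup>-\<^sup>1 v\<close> removes the existential quantifier in the definition, so that the
  equivalence properties become the homomorphism laws of \<open>\<rho>\<close>.
\<close>

lemma mem_assoc_rel_iff:
  "((u, g), (v, l)) \<in> assoc_rel \<Gamma> G H \<rho> \<longleftrightarrow>
    u \<in> carrier \<Gamma> \<and> g \<in> carrier G \<and> v \<in> carrier \<Gamma> \<and> l \<in> carrier G \<and>
    inv\<^bsub>\<Gamma>\<^esub> u \<otimes>\<^bsub>\<Gamma>\<^esub> v \<in> H \<and> g = \<rho> (inv\<^bsub>\<Gamma>\<^esub> u \<otimes>\<^bsub>\<Gamma>\<^esub> v) \<otimes>\<^bsub>G\<^esub> l" (is "?L \<longleftrightarrow> ?R")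
proof
  assume ?L
  then obtain h where h: "h \<in> H" "u \<in> carrier \<Gamma>" "g \<in> carrier G"
    "v = u \<otimes>\<^bsub>\<Gamma>\<^esub> h" "l = inv\<^bsub>G\<^esub> (\<rho> h) \<otimes>\<^bsub>G\<^esub> g"
    unfolding assoc_rel_def by blast
  moreover from h have "inv\<^bsub>\<Gamma>\<^esub> u \<otimes>\<^bsub>\<Gamma>\<^esub> v = h"
    by (simp add: \<Gamma>.m_assoc[symmetric])
  ultimately show ?R
    using rho_closed[OF h(1)] by (simp add: G.m_assoc[symmetric])
next
  assume R: ?R
  let ?h = "inv\<^bsub>\<Gamma>\<^esub> u \<otimes>\<^bsub>\<Gamma>\<^esub> v"
  have h: "?h \<in> H" "\<rho> ?h \<in> carrier G"
    using R rho_closed by auto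
  have v: "v = u \<otimes>\<^bsub>\<Gamma>\<^esub> ?h"
    using R by (simp add: \<Gamma>.m_assoc[symmetric])
  have "l = inv\<^bsub>G\<^esub> (\<rho> ?h) \<otimes>\<^bsub>G\<^esub> (\<rho> ?h \<otimes>\<^bsub>G\<^esub> l)"
    using R h(2) by (simp add: G.m_assoc[symmetric])
  then have l: "l = inv\<^bsub>G\<^esub> (\<rho> ?h) \<otimes>\<^bsub>G\<^esub> g"
    using R by metis
  show ?L
    unfolding assoc_rel_def using R h(1) v l by blast
qed

lemma equiv_assoc_rel: "equiv (carrier \<Gamma> \<times> carrier G) (assoc_rel \<Gamma> G H \<rho>)"
proof (rule equivI)
  show "assoc_rel \<Gamma> G H \<rho> \<subseteq> (carrier \<Gamma> \<times> carrier G) \<times> (carrier \<Gamma> \<times> carrier G)"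
    by (auto simp: mem_assoc_rel_iff)
  show "refl_on (carrier \<Gamma> \<times> carrier G) (assoc_rel \<Gamma> G H \<rho>)"
    by (auto simp: refl_on_def mem_assoc_rel_iff rho_one)
  show "sym (assoc_rel \<Gamma> G H \<rho>)"
  proof (rule symI)
    fix x y assume xy: "(x, y) \<in> assoc_rel \<Gamma> G H \<rho>"
    obtain u g v l where [simp]: "x = (u, g)" "y = (v, l)"
      by (cases x, cases y)
    note r = xy[simplified, unfolded mem_assoc_rel_iff]
    have h: "inv\<^bsub>\<Gamma>\<^esub> u \<otimes>\<^bsub>\<Gamma>\<^esub> v \<in> H"
      using r by blast
    have vu: "inv\<^bsub>\<Gamma>\<^esub> v \<otimes>\<^bsub>\<Gamma>\<^esub> u = inv\<^bsub>\<Gamma>\<^esub> (inv\<^bsub>\<Gamma>\<^esub> u \<otimes>\<^bsub>\<Gamma>\<^esub> v)"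
      using r by (simp add: \<Gamma>.inv_mult_group)
    have "inv\<^bsub>G\<^esub> (\<rho> (inv\<^bsub>\<Gamma>\<^esub> u \<otimes>\<^bsub>\<Gamma>\<^esub> v)) \<otimes>\<^bsub>G\<^esub> (\<rho> (inv\<^bsub>\<Gamma>\<^esub> u \<otimes>\<^bsub>\<Gamma>\<^esub> v) \<otimes>\<^bsub>G\<^esub> l) = l"
      using r rho_closed[OF h] by (simp add: G.m_assoc[symmetric])
    then show "(y, x) \<in> assoc_rel \<Gamma> G H \<rho>"
      using r H.m_inv_closed[OF h] unfolding \<open>x = _\<close> \<open>y = _\<close> mem_assoc_rel_iff vu rho_inv[OF h]
      by metis
  qed
  show "trans (assoc_rel \<Gamma> G H \<rho>)"
  proof (rule transI)
    fix x y z assume xy: "(x, y) \<in> assoc_rel \<Gamma> G H \<rho>" and yz: "(y, z) \<in> assoc_rel \<Gamma> G H \<rho>"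
    obtain u g v l w k where [simp]: "x = (u, g)" "y = (v, l)" "z = (w, k)"
      by (cases x, cases y, cases z)
    note r = xy[simplified, unfolded mem_assoc_rel_iff] yz[simplified, unfolded mem_assoc_rel_iff]
    have h: "inv\<^bsub>\<Gamma>\<^esub> u \<otimes>\<^bsub>\<Gamma>\<^esub> v \<in> H" "inv\<^bsub>\<Gamma>\<^esub> v \<otimes>\<^bsub>\<Gamma>\<^esub> w \<in> H"
      using r by blast+
    have uw: "inv\<^bsub>\<Gamma>\<^esub> u \<otimes>\<^bsub>\<Gamma>\<^esub> w = (inv\<^bsub>\<Gamma>\<^esub> u \<otimes>\<^bsub>\<Gamma>\<^esub> v) \<otimes>\<^bsub>\<Gamma>\<^esub> (inv\<^bsub>\<Gamma>\<^esub> v \<otimes>\<^bsub>\<Gamma>\<^esub> w)"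
    proof -
      have "v \<otimes>\<^bsub>\<Gamma>\<^esub> (inv\<^bsub>\<Gamma>\<^esub> v \<otimes>\<^bsub>\<Gamma>\<^esub> w) = w"
        using r by (simp add: \<Gamma>.m_assoc[symmetric])
      then show ?thesis
        using r by (simp add: \<Gamma>.m_assoc)
    qed
    have "g = \<rho> (inv\<^bsub>\<Gamma>\<^esub> u \<otimes>\<^bsub>\<Gamma>\<^esub> w) \<otimes>\<^bsub>G\<^esub> k"
      unfolding uw rho_mult[OF h] using r rho_closed[OF h(1)] rho_closed[OF h(2)]
      by (metis G.m_assoc)
    moreover have "inv\<^bsub>\<Gamma>\<^esub> u \<otimes>\<^bsub>\<Gamma>\<^esub> w \<in> H"
      unfolding uw using h by (rule H.m_closed)
    ultimately show "(x, z) \<in> assoc_rel \<Gamma> G H \<rho>"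
      using r unfolding \<open>x = _\<close> \<open>z = _\<close> mem_assoc_rel_iff by blast
  qed
qed

definition cls :: "'a \<Rightarrow> 'b \<Rightarrow> ('a \<times> 'b) set"
  where "cls u g = assoc_rel \<Gamma> G H \<rho> `` {(u, g)}"

lemma cls_eq_iff:
  assumes "u \<in> carrier \<Gamma>" "g \<in> carrier G" "v \<in> carrier \<Gamma>" "l \<in> carrier G"
  shows "cls u g = cls v l \<longleftrightarrow>
    inv\<^bsub>\<Gamma>\<^esub> u \<otimes>\<^bsub>\<Gamma>\<^esub> v \<in> H \<and> g = \<rho> (inv\<^bsub>\<Gamma>\<^esub> u \<otimes>\<^bsub>\<Gamma>\<^esub> v) \<otimes>\<^bsub>G\<^esub> l"
  using assms by (simp add: cls_def eq_equiv_class_iff[OF equiv_assoc_rel] mem_assoc_rel_iff)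

lemma cls_in_total:
  "\<lbrakk>u \<in> carrier \<Gamma>; g \<in> carrier G\<rbrakk> \<Longrightarrow> cls u g \<in> assoc_total \<Gamma> G H \<rho>"
  unfolding cls_def assoc_total_def by (rule quotientI) simp

lemma assoc_total_cases:
  assumes "p \<in> assoc_total \<Gamma> G H \<rho>"
  obtains u g where "u \<in> carrier \<Gamma>" "g \<in> carrier G" "p = cls u g"
  using assms unfolding cls_def assoc_total_def by (auto elim!: quotientE)

text \<open>
  The actions and the projection of the associated bundle are unions over representatives; this
  evaluates them at one representative, given invariance under the moves that generate the relation.
\<close>

lemma UN_cls:
  assumes resp: "\<And>v l h. \<lbrakk>v \<in> carrier \<Gamma>; l \<in> carrier G; h \<in> H\<rbrakk>
      \<Longrightarrow> F (v \<otimes>\<^bsub>\<Gamma>\<^esub> h) (inv\<^bsub>G\<^esub> (\<rho> h) \<otimes>\<^bsub>G\<^esub> l) = F v l"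
    and "u \<in> carrier \<Gamma>" "g \<in> carrier G"
  shows "(\<Union>(v, l)\<in>cls u g. F v l) = F u g"
proof -
  have "(\<lambda>(v, l). F v l) respects assoc_rel \<Gamma> G H \<rho>"
    by (rule congruentI) (auto simp: assoc_rel_def resp)
  from UN_equiv_class[OF equiv_assoc_rel this, of "(u, g)"] show ?thesis
    using assms(2,3) by (simp add: cls_def)
qed

lemma assoc_left_act:
  assumes "\<gamma> \<in> carrier \<Gamma>" "u \<in> carrier \<Gamma>" "g \<in> carrier G"
  shows "left_act (assoc_bundle \<Gamma> G H \<rho>) \<gamma> (cls u g) = cls (\<gamma> \<otimes>\<^bsub>\<Gamma>\<^esub> u) g"
proof -
  have "(\<Union>(v, l)\<in>cls u g. cls (\<gamma> \<otimes>\<^bsub>\<Gamma>\<^esub> v) l) = cls (\<gamma> \<otimes>\<^bsub>\<Gamma>\<^esub> u) g"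
  proof (rule UN_cls)
    fix v l h assume v: "v \<in> carrier \<Gamma>" and l: "l \<in> carrier G" and h: "h \<in> H"
    have "inv\<^bsub>\<Gamma>\<^esub> (\<gamma> \<otimes>\<^bsub>\<Gamma>\<^esub> v) \<otimes>\<^bsub>\<Gamma>\<^esub> (\<gamma> \<otimes>\<^bsub>\<Gamma>\<^esub> (v \<otimes>\<^bsub>\<Gamma>\<^esub> h)) = h"
      using v h assms(1)
      by (simp add: \<Gamma>.inv_mult_group \<Gamma>.m_assoc) (simp add: \<Gamma>.m_assoc[symmetric])
    then have "cls (\<gamma> \<otimes>\<^bsub>\<Gamma>\<^esub> v) l = cls (\<gamma> \<otimes>\<^bsub>\<Gamma>\<^esub> (v \<otimes>\<^bsub>\<Gamma>\<^esub> h)) (inv\<^bsub>G\<^esub> (\<rho> h) \<otimes>\<^bsub>G\<^esub> l)"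
      using v l h assms(1) rho_closed[OF h] by (simp add: cls_eq_iff G.m_assoc[symmetric])
    then show "cls (\<gamma> \<otimes>\<^bsub>\<Gamma>\<^esub> (v \<otimes>\<^bsub>\<Gamma>\<^esub> h)) (inv\<^bsub>G\<^esub> (\<rho> h) \<otimes>\<^bsub>G\<^esub> l) = cls (\<gamma> \<otimes>\<^bsub>\<Gamma>\<^esub> v) l" ..
  qed (use assms in auto)
  then show ?thesis
    using assms by (simp add: assoc_bundle_def cls_in_total flip: cls_def)
qed

lemma assoc_right_act:
  assumes "u \<in> carrier \<Gamma>" "g \<in> carrier G" "k \<in> carrier G"
  shows "right_act (assoc_bundle \<Gamma> G H \<rho>) (cls u g) k = cls u (g \<otimes>\<^bsub>G\<^esub> k)"
proof -
  have "(\<Union>(v, l)\<in>cls u g. cls v (l \<otimes>\<^bsub>G\<^esub> k)) = cls u (g \<otimes>\<^bsub>G\<^esub> k)"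
  proof (rule UN_cls)
    fix v l h assume v: "v \<in> carrier \<Gamma>" and l: "l \<in> carrier G" and h: "h \<in> H"
    have "inv\<^bsub>\<Gamma>\<^esub> v \<otimes>\<^bsub>\<Gamma>\<^esub> (v \<otimes>\<^bsub>\<Gamma>\<^esub> h) = h"
      using v h by (simp add: \<Gamma>.m_assoc[symmetric])
    then have "cls v (l \<otimes>\<^bsub>G\<^esub> k) = cls (v \<otimes>\<^bsub>\<Gamma>\<^esub> h) (inv\<^bsub>G\<^esub> (\<rho> h) \<otimes>\<^bsub>G\<^esub> l \<otimes>\<^bsub>G\<^esub> k)"
      using v l h assms(3) rho_closed[OF h] by (simp add: cls_eq_iff G.m_assoc[symmetric])
    then show "cls (v \<otimes>\<^bsub>\<Gamma>\<^esub> h) (inv\<^bsub>G\<^esub> (\<rho> h) \<otimes>\<^bsub>G\<^esub> l \<otimes>\<^bsub>G\<^esub> k) = cls v (l \<otimes>\<^bsub>G\<^esub> k)" ..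
  qed (use assms in auto)
  then show ?thesis
    by (simp add: assoc_bundle_def flip: cls_def)
qed

lemma assoc_proj:
  assumes "u \<in> carrier \<Gamma>" "g \<in> carrier G"
  shows "bundle_proj (assoc_bundle \<Gamma> G H \<rho>) (cls u g) = u <#\<^bsub>\<Gamma>\<^esub> H"
proof -
  have "(\<Union>(v, l)\<in>cls u g. v <#\<^bsub>\<Gamma>\<^esub> H) = u <#\<^bsub>\<Gamma>\<^esub> H"
  proof (rule UN_cls)
    fix v h assume v: "v \<in> carrier \<Gamma>" and h: "h \<in> H"
    have "inv\<^bsub>\<Gamma>\<^esub> v \<otimes>\<^bsub>\<Gamma>\<^esub> (v \<otimes>\<^bsub>\<Gamma>\<^esub> h) = h"
      using v h by (simp add: \<Gamma>.m_assoc[symmetric])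
    then show "v \<otimes>\<^bsub>\<Gamma>\<^esub> h <#\<^bsub>\<Gamma>\<^esub> H = v <#\<^bsub>\<Gamma>\<^esub> H"
      using v h by (simp add: \<Gamma>.l_coset_eq_iff[OF H.subgroup_axioms])
  qed (use assms in auto)
  then show ?thesis
    by (simp add: assoc_bundle_def)
qed

lemma assoc_base_act:
  assumes "\<gamma> \<in> carrier \<Gamma>" "u \<in> carrier \<Gamma>"
  shows "base_act (assoc_bundle \<Gamma> G H \<rho>) \<gamma> (u <#\<^bsub>\<Gamma>\<^esub> H) = \<gamma> \<otimes>\<^bsub>\<Gamma>\<^esub> u <#\<^bsub>\<Gamma>\<^esub> H"
  using assms \<Gamma>.lcos_m_assoc[OF H.subset] by (auto simp: assoc_bundle_def LCOSETS_def)

lemma assoc_base_action: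
  "transitive_action \<Gamma> (lcosets\<^bsub>\<Gamma>\<^esub> H) (base_act (assoc_bundle \<Gamma> G H \<rho>))"
proof (intro transitive_action.intro transitive_action_axioms.intro \<Gamma>.group_actionI)
  show "base_act (assoc_bundle \<Gamma> G H \<rho>) \<gamma> \<in> extensional (lcosets\<^bsub>\<Gamma>\<^esub> H)" for \<gamma>
    by (simp add: assoc_bundle_def)
  fix x y assume "x \<in> lcosets\<^bsub>\<Gamma>\<^esub> H" "y \<in> lcosets\<^bsub>\<Gamma>\<^esub> H"
  then obtain u v where uv: "u \<in> carrier \<Gamma>" "x = u <#\<^bsub>\<Gamma>\<^esub> H" "v \<in> carrier \<Gamma>" "y = v <#\<^bsub>\<Gamma>\<^esub> H"
    by (auto simp: LCOSETS_def)
  then have "base_act (assoc_bundle \<Gamma> G H \<rho>) (v \<otimes>\<^bsub>\<Gamma>\<^esub> inv\<^bsub>\<Gamma>\<^esub> u) x = y"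
    by (simp add: assoc_base_act \<Gamma>.m_assoc)
  then show "\<exists>\<gamma>\<in>carrier \<Gamma>. base_act (assoc_bundle \<Gamma> G H \<rho>) \<gamma> x = y"
    using uv by blast
qed (auto simp: LCOSETS_def assoc_base_act \<Gamma>.m_assoc)

lemma assoc_total_action:
  "group_action \<Gamma> (assoc_total \<Gamma> G H \<rho>) (left_act (assoc_bundle \<Gamma> G H \<rho>))"
proof (rule \<Gamma>.group_actionI)
  show "left_act (assoc_bundle \<Gamma> G H \<rho>) \<gamma> \<in> extensional (assoc_total \<Gamma> G H \<rho>)" for \<gamma>
    by (simp add: assoc_bundle_def)
qed (auto elim!: assoc_total_cases simp: assoc_left_act cls_in_total \<Gamma>.m_assoc)

lemma assoc_fibre_eq_orbit:
  assumes u: "u \<in> carrier \<Gamma>" and g: "g \<in> carrier G"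
  shows "{p \<in> assoc_total \<Gamma> G H \<rho>. bundle_proj (assoc_bundle \<Gamma> G H \<rho>) p = u <#\<^bsub>\<Gamma>\<^esub> H}
    = right_act (assoc_bundle \<Gamma> G H \<rho>) (cls u g) ` carrier G"
proof (intro equalityI subsetI)
  fix p
  assume "p \<in> {p \<in> assoc_total \<Gamma> G H \<rho>. bundle_proj (assoc_bundle \<Gamma> G H \<rho>) p = u <#\<^bsub>\<Gamma>\<^esub> H}"
  then obtain v l where v: "v \<in> carrier \<Gamma>" and l: "l \<in> carrier G" and p: "p = cls v l"
    and "v <#\<^bsub>\<Gamma>\<^esub> H = u <#\<^bsub>\<Gamma>\<^esub> H"
    by (auto elim!: assoc_total_cases simp: assoc_proj)
  then have h: "inv\<^bsub>\<Gamma>\<^esub> u \<otimes>\<^bsub>\<Gamma>\<^esub> v \<in> H"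
    using u by (simp add: \<Gamma>.l_coset_eq_iff[OF H.subgroup_axioms])
  let ?l = "\<rho> (inv\<^bsub>\<Gamma>\<^esub> u \<otimes>\<^bsub>\<Gamma>\<^esub> v) \<otimes>\<^bsub>G\<^esub> l"
  have l': "?l \<in> carrier G"
    using rho_closed[OF h] l by simp
  have "cls u ?l = cls v l"
    using u v l l' h by (simp add: cls_eq_iff)
  moreover have "g \<otimes>\<^bsub>G\<^esub> (inv\<^bsub>G\<^esub> g \<otimes>\<^bsub>G\<^esub> ?l) = ?l"
    using G.m_assoc[OF g G.inv_closed[OF g] l'] g l' by simp
  then have "right_act (assoc_bundle \<Gamma> G H \<rho>) (cls u g) (inv\<^bsub>G\<^esub> g \<otimes>\<^bsub>G\<^esub> ?l) = cls u ?l"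
    using assoc_right_act[OF u g G.m_closed[OF G.inv_closed[OF g] l']] by simp
  ultimately show "p \<in> right_act (assoc_bundle \<Gamma> G H \<rho>) (cls u g) ` carrier G"
    using p g l' by (metis G.inv_closed G.m_closed image_eqI)
next
  fix p assume "p \<in> right_act (assoc_bundle \<Gamma> G H \<rho>) (cls u g) ` carrier G"
  then show "p \<in> {p \<in> assoc_total \<Gamma> G H \<rho>. bundle_proj (assoc_bundle \<Gamma> G H \<rho>) p = u <#\<^bsub>\<Gamma>\<^esub> H}"
    using u g by (auto simp: assoc_right_act cls_in_total assoc_proj)
qed

lemma assoc_bundle_simps [simp]:
  "total_space (assoc_bundle \<Gamma> G H \<rho>) = assoc_total \<Gamma> G H \<rho>"
  "base_space (assoc_bundle \<Gamma> G H \<rho>) = lcosets\<^bsub>\<Gamma>\<^esub> H"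
  by (simp_all add: assoc_bundle_def)

lemma assoc_bundle_is_bundle: "equivariant_principal_bundle \<Gamma> G (assoc_bundle \<Gamma> G H \<rho>)"
proof (intro equivariant_principal_bundle.intro equivariant_principal_bundle_axioms.intro,
    unfold assoc_bundle_simps)
  show "group_action \<Gamma> (lcosets\<^bsub>\<Gamma>\<^esub> H) (base_act (assoc_bundle \<Gamma> G H \<rho>))"
    using assoc_base_action by (rule transitive_action.axioms(1))
  let ?B = "assoc_bundle \<Gamma> G H \<rho>"
  let ?fibre = "\<lambda>z. {p \<in> assoc_total \<Gamma> G H \<rho>. bundle_proj ?B p = z}"
  let ?orbit = "\<lambda>p. right_act ?B p ` carrier G"
  show "?fibre ` (lcosets\<^bsub>\<Gamma>\<^esub> H) = ?orbit ` assoc_total \<Gamma> G H \<rho>"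
  proof (intro equalityI image_subsetI)
    fix z assume "z \<in> lcosets\<^bsub>\<Gamma>\<^esub> H"
    then obtain u where u: "u \<in> carrier \<Gamma>" "z = u <#\<^bsub>\<Gamma>\<^esub> H"
      by (auto simp: LCOSETS_def)
    have "?fibre z = ?orbit (cls u \<one>\<^bsub>G\<^esub>)"
      unfolding u(2) by (rule assoc_fibre_eq_orbit[OF u(1) G.one_closed])
    then show "?fibre z \<in> ?orbit ` assoc_total \<Gamma> G H \<rho>"
      using cls_in_total[OF u(1) G.one_closed] by (rule image_eqI)
  next
    fix p assume "p \<in> assoc_total \<Gamma> G H \<rho>"
    then obtain u g where u: "u \<in> carrier \<Gamma>" and g: "g \<in> carrier G" and p: "p = cls u g"
      by (rule assoc_total_cases)
    have "?orbit p = ?fibre (u <#\<^bsub>\<Gamma>\<^esub> H)"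
      unfolding p by (rule assoc_fibre_eq_orbit[OF u g, symmetric])
    moreover have "u <#\<^bsub>\<Gamma>\<^esub> H \<in> lcosets\<^bsub>\<Gamma>\<^esub> H"
      using u by (auto simp: LCOSETS_def)
    ultimately show "?orbit p \<in> ?fibre ` (lcosets\<^bsub>\<Gamma>\<^esub> H)"
      by (rule image_eqI)
  qed
next
  fix p k assume p: "p \<in> assoc_total \<Gamma> G H \<rho>" and k: "k \<in> carrier G"
    and stab: "right_act (assoc_bundle \<Gamma> G H \<rho>) p k = p"
  obtain u g where u: "u \<in> carrier \<Gamma>" and g: "g \<in> carrier G" and p: "p = cls u g"
    using p by (rule assoc_total_cases)
  have "g \<otimes>\<^bsub>G\<^esub> k = g"
    using stab u g k by (simp add: p assoc_right_act cls_eq_iff rho_one)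
  then show "k = \<one>\<^bsub>G\<^esub>"
    using g k by simp
qed (auto elim!: assoc_total_cases intro: assoc_total_action
    simp: assoc_left_act assoc_right_act assoc_proj assoc_base_act cls_in_total G.m_assoc
      LCOSETS_def)

lemma assoc_bundle_irreducible: "irreducible_bundle \<Gamma> G (assoc_bundle \<Gamma> G H \<rho>)"
  unfolding irreducible_bundle_def assoc_bundle_simps
  using assoc_bundle_is_bundle assoc_base_action by (auto simp: LCOSETS_def)

text \<open>
  The class of \<open>(h, 1)\<close> equals that of \<open>(1, k)\<close> exactly if \<open>h \<in> H\<close> and \<open>k = \<rho>(h)\<close>.
\<close>

lemma assoc_isotropy_rep:
  "isotropy_rep \<Gamma> G (assoc_bundle \<Gamma> G H \<rho>) (cls \<one>\<^bsub>\<Gamma>\<^esub> \<one>\<^bsub>G\<^esub>) H \<rho>"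
proof -
  have act: "left_act (assoc_bundle \<Gamma> G H \<rho>) h (cls \<one>\<^bsub>\<Gamma>\<^esub> \<one>\<^bsub>G\<^esub>)
        = right_act (assoc_bundle \<Gamma> G H \<rho>) (cls \<one>\<^bsub>\<Gamma>\<^esub> \<one>\<^bsub>G\<^esub>) k \<longleftrightarrow> h \<in> H \<and> \<rho> h = k"
    if h: "h \<in> carrier \<Gamma>" and k: "k \<in> carrier G" for h k
  proof -
    have "cls h \<one>\<^bsub>G\<^esub> = cls \<one>\<^bsub>\<Gamma>\<^esub> k \<longleftrightarrow> h \<in> H \<and> k = \<rho> h"
      using h k rho_closed by (subst eq_commute) (auto simp: cls_eq_iff)
    then show ?thesis
      using h k by (auto simp: assoc_left_act assoc_right_act)
  qed
  then have "H = {h \<in> carrier \<Gamma>. \<exists>k\<in>carrier G.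
      left_act (assoc_bundle \<Gamma> G H \<rho>) h (cls \<one>\<^bsub>\<Gamma>\<^esub> \<one>\<^bsub>G\<^esub>)
        = right_act (assoc_bundle \<Gamma> G H \<rho>) (cls \<one>\<^bsub>\<Gamma>\<^esub> \<one>\<^bsub>G\<^esub>) k}"
    using H.subset rho_closed by blast
  moreover have "\<rho> \<in> extensional H"
    using Hom by (simp add: Hom_def)
  ultimately show ?thesis
    using act rho_closed H.subset unfolding isotropy_rep_def
    by (simp add: cls_in_total subset_iff)
qed

end

section \<open>The classification\<close>

lemma bundle_iso_rel_equiv:
  "equiv (irreducible_bundles \<Gamma> G n) (bundle_iso_rel \<Gamma> G n)"
proof (rule equivI)
  show "bundle_iso_rel \<Gamma> G n \<subseteq> irreducible_bundles \<Gamma> G n \<times> irreducible_bundles \<Gamma> G n"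
    by (auto simp: bundle_iso_rel_def)
  show "refl_on (irreducible_bundles \<Gamma> G n) (bundle_iso_rel \<Gamma> G n)"
    by (auto simp: refl_on_def bundle_iso_rel_def bundle_isomorphic_refl)
  show "sym (bundle_iso_rel \<Gamma> G n)"
    by (auto intro!: symI equivariant_principal_bundle.bundle_isomorphic_sym
        simp: bundle_iso_rel_def irreducible_bundles_def irreducible_bundle_def)
  show "trans (bundle_iso_rel \<Gamma> G n)"
    by (auto intro!: transI intro: bundle_isomorphic_trans simp: bundle_iso_rel_def)
qed

lemma isotropy_rep_index:
  assumes B: "B \<in> irreducible_bundles \<Gamma> G n" and rep: "isotropy_rep \<Gamma> G B p H \<rho>"
  shows "H \<in> index_subgroups \<Gamma> n"
proof -
  interpret equivariant_principal_bundle \<Gamma> G B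
    using B by (simp add: irreducible_bundles_def irreducible_bundle_def)
  interpret base: transitive_action \<Gamma> "base_space B" "base_act B"
    using B by (simp add: irreducible_bundles_def irreducible_bundle_def)
  have "bij_betw (\<lambda>y. {u \<in> carrier \<Gamma>. base_act B u (bundle_proj B p) = y})
      (base_space B) (lcosets\<^bsub>\<Gamma>\<^esub> H)"
    unfolding isotropy_rep_stabilizer[OF rep]
    by (intro base.bij_betw_lcosets_stabilizer proj_closed isotropy_rep_point[OF rep])
  then have "finite (lcosets\<^bsub>\<Gamma>\<^esub> H) \<and> card (lcosets\<^bsub>\<Gamma>\<^esub> H) = n"
    using B bij_betw_finite bij_betw_same_card unfolding irreducible_bundles_def by fastforce
  then show ?thesis
    using isotropy_rep_subgroup[OF rep] by (simp add: index_subgroups_def)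
qed

text \<open>
  For a fixed subgroup the condition \<open>u H u\<^sup>-\<^sup>1 = H\<close> in the conjugacy criterion says that \<open>u\<close>
  normalizes \<open>H\<close>. Described in this way, orbits inherit from bundle isomorphism that they are the
  classes of an equivalence relation.
\<close>

lemma Hom_orbit_eq_isomorphic:
  assumes "group \<Gamma>" and "group G" and H: "subgroup H \<Gamma>" and \<rho>: "\<rho> \<in> Hom \<Gamma> G H"
  shows "orbit (Hom_group \<Gamma> G H) (Hom_act \<Gamma> G H) \<rho>
    = {\<sigma> \<in> Hom \<Gamma> G H. bundle_isomorphic \<Gamma> G (assoc_bundle \<Gamma> G H \<rho>) (assoc_bundle \<Gamma> G H \<sigma>)}"
proof -
  interpret \<rho>: subgroup_hom \<Gamma> G H \<rho>
    using assms by (intro subgroup_hom.intro subgroup_hom_axioms.intro)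
  interpret B: equivariant_principal_bundle \<Gamma> G "assoc_bundle \<Gamma> G H \<rho>"
    by (rule \<rho>.assoc_bundle_is_bundle)
  let ?act = "\<lambda>u g. \<lambda>h\<in>H. g \<otimes>\<^bsub>G\<^esub> \<rho> (inv\<^bsub>\<Gamma>\<^esub> u \<otimes>\<^bsub>\<Gamma>\<^esub> h \<otimes>\<^bsub>\<Gamma>\<^esub> u) \<otimes>\<^bsub>G\<^esub> inv\<^bsub>G\<^esub> g"
  have orbit: "\<sigma> \<in> orbit (Hom_group \<Gamma> G H) (Hom_act \<Gamma> G H) \<rho> \<longleftrightarrow>
      (\<exists>u\<in>carrier \<Gamma>. \<exists>g\<in>carrier G. H = u <#\<^bsub>\<Gamma>\<^esub> H #>\<^bsub>\<Gamma>\<^esub> inv\<^bsub>\<Gamma>\<^esub> u \<and> \<sigma> = ?act u g)" for \<sigma>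
  proof -
    have N: "u \<in> normalizer \<Gamma> H
        \<longleftrightarrow> u \<in> carrier \<Gamma> \<and> H = u <#\<^bsub>\<Gamma>\<^esub> H #>\<^bsub>\<Gamma>\<^esub> inv\<^bsub>\<Gamma>\<^esub> u" for u
      using \<rho>.\<Gamma>.mem_normalizer_iff[OF \<rho>.H.subset] by metis
    have C: "carrier (Hom_group \<Gamma> G H) = normalizer \<Gamma> H \<times> carrier G"
      by (simp add: Hom_group_def DirProd_def)
    have A: "Hom_act \<Gamma> G H (u, g) \<rho> = ?act u g" for u g
      using \<rho> by (simp add: Hom_act_def)
    have "\<sigma> \<in> orbit (Hom_group \<Gamma> G H) (Hom_act \<Gamma> G H) \<rho>
        \<longleftrightarrow> (\<exists>u\<in>normalizer \<Gamma> H. \<exists>g\<in>carrier G. \<sigma> = ?act u g)"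
      unfolding orbit_def C A[symmetric] by blast
    then show ?thesis
      by (simp only: N Bex_def conj_assoc ex_simps(2)[symmetric] conj_left_commute)
  qed
  have iso: "bundle_isomorphic \<Gamma> G (assoc_bundle \<Gamma> G H \<rho>) (assoc_bundle \<Gamma> G H \<sigma>)
      \<longleftrightarrow> \<sigma> \<in> orbit (Hom_group \<Gamma> G H) (Hom_act \<Gamma> G H) \<rho>" if "\<sigma> \<in> Hom \<Gamma> G H" for \<sigma>
  proof -
    interpret \<sigma>: subgroup_hom \<Gamma> G H \<sigma>
      using assms that by (intro subgroup_hom.intro subgroup_hom_axioms.intro)
    show ?thesis
      unfolding orbit
      by (rule bundle_isomorphic_iff_conjugate_isotropy_rep[OF \<rho>.assoc_bundle_irreducible
            \<sigma>.assoc_bundle_irreducible \<rho>.assoc_isotropy_rep \<sigma>.assoc_isotropy_rep])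
  qed
  have "\<sigma> \<in> Hom \<Gamma> G H" if mem: "\<sigma> \<in> orbit (Hom_group \<Gamma> G H) (Hom_act \<Gamma> G H) \<rho>" for \<sigma>
  proof -
    obtain u g where u: "u \<in> carrier \<Gamma>" and g: "g \<in> carrier G"
      and N: "H = u <#\<^bsub>\<Gamma>\<^esub> H #>\<^bsub>\<Gamma>\<^esub> inv\<^bsub>\<Gamma>\<^esub> u" and \<sigma>: "\<sigma> = ?act u g"
      using mem unfolding orbit by blast
    show ?thesis
      unfolding \<sigma>
      by (rule B.isotropy_rep_Hom[OF B.isotropy_rep_translate[OF \<rho>.assoc_isotropy_rep u g, folded N]])
  qed
  then show ?thesis
    using iso by blast
qed

text \<open>
  The isotropy group at an arbitrary point need not be a chosen representative, but it is
  conjugate to one, and moving the point realizes this conjugation.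
\<close>

lemma irreducible_isomorphic_assoc_bundle:
  assumes \<Gamma>: "group \<Gamma>" and G: "group G"
    and R: "conjugacy_representatives \<Gamma> (index_subgroups \<Gamma> n) R"
    and B: "B \<in> irreducible_bundles \<Gamma> G n"
  obtains H \<rho> where "H \<in> R" "\<rho> \<in> Hom \<Gamma> G H"
    "bundle_isomorphic \<Gamma> G B (assoc_bundle \<Gamma> G H \<rho>)"
proof -
  have irr: "irreducible_bundle \<Gamma> G B"
    using B by (simp add: irreducible_bundles_def)
  interpret equivariant_principal_bundle \<Gamma> G B
    using irr by (simp add: irreducible_bundle_def)
  obtain z where z: "z \<in> base_space B"
    using irr by (auto simp: irreducible_bundle_def)
  have "{p \<in> total_space B. bundle_proj B p = z}
      \<in> (\<lambda>p. right_act B p ` carrier G) ` total_space B"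
    using z unfolding fibres_eq_orbits[symmetric] by (rule imageI)
  then obtain p where p: "p \<in> total_space B"
    by blast
  obtain K \<sigma> where rep: "isotropy_rep \<Gamma> G B p K \<sigma>"
    using isotropy_rep_exists[OF p] .
  obtain H u where H: "H \<in> R" and u: "u \<in> carrier \<Gamma>"
    and conj: "H = u <#\<^bsub>\<Gamma>\<^esub> K #>\<^bsub>\<Gamma>\<^esub> inv\<^bsub>\<Gamma>\<^esub> u"
    using R isotropy_rep_index[OF B rep] unfolding conjugacy_representatives_def by blast
  obtain q \<rho> where rep': "isotropy_rep \<Gamma> G B q H \<rho>"
    using isotropy_rep_translate[OF rep u G.one_closed, folded conj] by blast
  interpret \<rho>: subgroup_hom \<Gamma> G H \<rho>
    using \<Gamma> G isotropy_rep_subgroup[OF rep'] isotropy_rep_Hom[OF rep']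
    by (intro subgroup_hom.intro subgroup_hom_axioms.intro)
  show thesis
    using H \<rho>.Hom bundle_isomorphic_if_same_isotropy_rep[OF irr \<rho>.assoc_bundle_irreducible rep'
        \<rho>.assoc_isotropy_rep] by (rule that)
qed

text \<open>
  Isomorphic bundles have conjugate isotropy groups, and a class contains one representative only.
\<close>

lemma assoc_bundle_isomorphic_imp_eq:
  assumes \<Gamma>: "group \<Gamma>" and G: "group G"
    and R: "conjugacy_representatives \<Gamma> (index_subgroups \<Gamma> n) R"
    and H: "H \<in> R" "\<rho> \<in> Hom \<Gamma> G H" and K: "K \<in> R" "\<sigma> \<in> Hom \<Gamma> G K"
    and iso: "bundle_isomorphic \<Gamma> G (assoc_bundle \<Gamma> G H \<rho>) (assoc_bundle \<Gamma> G K \<sigma>)"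
  shows "K = H"
proof -
  have ind: "H \<in> index_subgroups \<Gamma> n" "K \<in> index_subgroups \<Gamma> n"
    using R H(1) K(1) unfolding conjugacy_representatives_def by blast+
  interpret \<rho>: subgroup_hom \<Gamma> G H \<rho>
    using \<Gamma> G H ind by (intro subgroup_hom.intro subgroup_hom_axioms.intro)
      (simp_all add: index_subgroups_def)
  interpret \<sigma>: subgroup_hom \<Gamma> G K \<sigma>
    using \<Gamma> G K ind by (intro subgroup_hom.intro subgroup_hom_axioms.intro)
      (simp_all add: index_subgroups_def)
  obtain u where u: "u \<in> carrier \<Gamma>" "K = u <#\<^bsub>\<Gamma>\<^esub> H #>\<^bsub>\<Gamma>\<^esub> inv\<^bsub>\<Gamma>\<^esub> u"
    using iso bundle_isomorphic_iff_conjugate_isotropy_rep[OF \<rho>.assoc_bundle_irreducible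
        \<sigma>.assoc_bundle_irreducible \<rho>.assoc_isotropy_rep \<sigma>.assoc_isotropy_rep] by blast
  \<comment> \<open>Both \<open>K\<close> and \<open>H\<close> are then representatives conjugate to \<open>H\<close>, so uniqueness applies.\<close>
  have "H = \<one>\<^bsub>\<Gamma>\<^esub> <#\<^bsub>\<Gamma>\<^esub> H #>\<^bsub>\<Gamma>\<^esub> inv\<^bsub>\<Gamma>\<^esub> \<one>\<^bsub>\<Gamma>\<^esub>"
    using \<rho>.H.subset by (simp add: \<rho>.\<Gamma>.lcos_mult_one \<rho>.\<Gamma>.coset_mult_one)
  then show ?thesis
    using R ind(1) H(1) K(1) u \<rho>.\<Gamma>.one_closed unfolding conjugacy_representatives_def by metis
qed

theorem theoremE:
  fixes \<Gamma> :: "('a, 'm) monoid_scheme" and G :: "('b, 'k) monoid_scheme"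
    and n :: nat and R :: "'a set set"
  assumes "group \<Gamma>" and "group G" and "n \<ge> 1"
    and "conjugacy_representatives \<Gamma> (index_subgroups \<Gamma> n) R"
  shows "\<exists>\<Phi>. bij_betw \<Phi> (SIGMA H:R. Hom_classes \<Gamma> G H)
          ((irreducible_bundles \<Gamma> G n :: ('a, 'b, ('a \<times> 'b) set, 'a set) principal_bundle set)
            // bundle_iso_rel \<Gamma> G n)
      \<and> (\<forall>H\<in>R. \<forall>\<rho>\<in>Hom \<Gamma> G H.
          \<Phi> (H, orbit (Hom_group \<Gamma> G H) (Hom_act \<Gamma> G H) \<rho>)
            = bundle_iso_rel \<Gamma> G n `` {assoc_bundle \<Gamma> G H \<rho>})
      \<and> (\<forall>Q \<in> (irreducible_bundles \<Gamma> G n :: ('a, 'b, 'p, 'z) principal_bundle set).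
          \<exists>!c. c \<in> (SIGMA H:R. Hom_classes \<Gamma> G H) \<and> (\<exists>B\<in>\<Phi> c. bundle_isomorphic \<Gamma> G Q B))"
proof -
  note R = assms(4)
  let ?P = "assoc_bundle \<Gamma> G"
  let ?orbit = "\<lambda>H. orbit (Hom_group \<Gamma> G H) (Hom_act \<Gamma> G H)"
  let ?r = "bundle_iso_rel \<Gamma> G n
    :: ('a, 'b, ('a \<times> 'b) set, 'a set) principal_bundle rel"
  have sub: "subgroup H \<Gamma>" if "H \<in> R" for H
    using R that by (auto simp: conjugacy_representatives_def index_subgroups_def)
  have P: "?P H \<rho> \<in> irreducible_bundles \<Gamma> G n" if "H \<in> R" "\<rho> \<in> Hom \<Gamma> G H" for H \<rho>
  proof -
    interpret subgroup_hom \<Gamma> G H \<rho>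
      using assms that sub by (intro subgroup_hom.intro subgroup_hom_axioms.intro)
    show ?thesis
      using assoc_bundle_irreducible R that(1)
      by (auto simp: irreducible_bundles_def conjugacy_representatives_def index_subgroups_def)
  qed
  have equiv: "equiv (irreducible_bundles \<Gamma> G n) ?r"
    by (rule bundle_iso_rel_equiv)
  have orbit: "?orbit H \<rho> = {\<sigma> \<in> Hom \<Gamma> G H. bundle_isomorphic \<Gamma> G (?P H \<rho>) (?P H \<sigma>)}"
    if "H \<in> R" "\<rho> \<in> Hom \<Gamma> G H" for H \<rho>
    using Hom_orbit_eq_isomorphic[OF assms(1,2) sub[OF that(1)] that(2)] .
  have sym: "bundle_isomorphic \<Gamma> G B' B"
    if "B \<in> irreducible_bundles \<Gamma> G n" "bundle_isomorphic \<Gamma> G B B'"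
    for B :: "('a, 'b, ('a \<times> 'b) set, 'a set) principal_bundle"
      and B' :: "('a, 'b, ('a \<times> 'b) set, 'a set) principal_bundle"
    using that equivariant_principal_bundle.bundle_isomorphic_sym
    unfolding irreducible_bundles_def irreducible_bundle_def by blast
  have same: "(H, ?orbit H \<rho>) = (K, ?orbit K \<sigma>)"
    if H: "H \<in> R" "\<rho> \<in> Hom \<Gamma> G H" and K: "K \<in> R" "\<sigma> \<in> Hom \<Gamma> G K"
      and iso: "bundle_isomorphic \<Gamma> G (?P H \<rho>) (?P K \<sigma>)" for H \<rho> K \<sigma>
  proof -
    have [simp]: "K = H"
      using assoc_bundle_isomorphic_imp_eq[OF assms(1,2) R H K iso] .
    have "?orbit H \<rho> = ?orbit H \<sigma>"
      using K unfolding orbit[OF H] orbit[OF K, simplified]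
      by (auto intro: bundle_isomorphic_trans iso[simplified] sym[OF P[OF H] iso, simplified])
    then show ?thesis by simp
  qed
  \<comment> \<open>All elements of \<open>c\<close> give the same isomorphism class, so the union over \<open>c\<close> avoids a choice.\<close>
  define \<Phi> where "\<Phi> = (\<lambda>(H, c). ?r `` (?P H ` c))"
  have \<Phi>: "\<Phi> (H, ?orbit H \<rho>) = ?r `` {?P H \<rho>}" if H: "H \<in> R" "\<rho> \<in> Hom \<Gamma> G H" for H \<rho>
  proof -
    have const: "?r `` {?P H \<sigma>} = ?r `` {?P H \<rho>}" if "\<sigma> \<in> ?orbit H \<rho>" for \<sigma>
      using that H P orbit[OF H] 
      by (intro equiv_class_eq[OF equiv, symmetric]) (auto simp: bundle_iso_rel_def)
    have self: "\<rho> \<in> ?orbit H \<rho>"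
      using H orbit[OF H] bundle_isomorphic_refl by blast
    have "\<Phi> (H, ?orbit H \<rho>) = (\<Union>\<sigma>\<in>?orbit H \<rho>. ?r `` {?P H \<sigma>})"
      unfolding \<Phi>_def by blast
    also have "\<dots> = ?r `` {?P H \<rho>}"
      by (rule UN_constant_eq[OF self]) (intro ballI const)
    finally show ?thesis .
  qed
  have cases: "\<exists>H \<rho>. H \<in> R \<and> \<rho> \<in> Hom \<Gamma> G H \<and> c = (H, ?orbit H \<rho>)"
    if "c \<in> (SIGMA H:R. Hom_classes \<Gamma> G H)" for c
    using that by (auto simp: Hom_classes_def orbits_def)
  have mem: "(H, ?orbit H \<rho>) \<in> (SIGMA H:R. Hom_classes \<Gamma> G H)"
    if "H \<in> R" "\<rho> \<in> Hom \<Gamma> G H" for H \<rho>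
    using that by (auto simp: Hom_classes_def orbits_def)
  have bij: "bij_betw \<Phi> (SIGMA H:R. Hom_classes \<Gamma> G H) (irreducible_bundles \<Gamma> G n // ?r)"
  proof (rule bij_betw_imageI)
    show "inj_on \<Phi> (SIGMA H:R. Hom_classes \<Gamma> G H)"
    proof (rule inj_onI)
      fix c d assume c: "c \<in> (SIGMA H:R. Hom_classes \<Gamma> G H)"
        and d: "d \<in> (SIGMA H:R. Hom_classes \<Gamma> G H)" and eq: "\<Phi> c = \<Phi> d"
      obtain H \<rho> where H: "H \<in> R" "\<rho> \<in> Hom \<Gamma> G H" "c = (H, ?orbit H \<rho>)"
        using cases[OF c] by blast
      obtain K \<sigma> where K: "K \<in> R" "\<sigma> \<in> Hom \<Gamma> G K" "d = (K, ?orbit K \<sigma>)"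
        using cases[OF d] by blast
      have "(?P H \<rho>, ?P K \<sigma>) \<in> ?r"
        using eq \<Phi>[OF H(1,2)] \<Phi>[OF K(1,2)] H(3) K(3) P[OF K(1,2)]
        by (intro eq_equiv_class[OF _ equiv]) simp_all
      then show "c = d"
        unfolding H(3) K(3) by (intro same H K) (simp add: bundle_iso_rel_def)
    qed
    show "\<Phi> ` (SIGMA H:R. Hom_classes \<Gamma> G H) = irreducible_bundles \<Gamma> G n // ?r"
    proof (intro equalityI subsetI)
      fix X assume "X \<in> \<Phi> ` (SIGMA H:R. Hom_classes \<Gamma> G H)"
      then obtain c where c: "c \<in> (SIGMA H:R. Hom_classes \<Gamma> G H)" "X = \<Phi> c"
        by (rule imageE)
      obtain H \<rho> where H: "H \<in> R" "\<rho> \<in> Hom \<Gamma> G H" "c = (H, ?orbit H \<rho>)"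
        using cases[OF c(1)] by blast
      show "X \<in> irreducible_bundles \<Gamma> G n // ?r"
        unfolding c(2) H(3) \<Phi>[OF H(1,2)] by (intro quotientI P H)
    next
      fix X assume "X \<in> irreducible_bundles \<Gamma> G n // ?r"
      then obtain B where B: "B \<in> irreducible_bundles \<Gamma> G n" and X: "X = ?r `` {B}"
        by (auto elim: quotientE)
      obtain H \<rho> where H: "H \<in> R" "\<rho> \<in> Hom \<Gamma> G H"
        and iso: "bundle_isomorphic \<Gamma> G B (?P H \<rho>)"
        using irreducible_isomorphic_assoc_bundle[OF assms(1,2) R B] by blast
      have "X = \<Phi> (H, ?orbit H \<rho>)"
        unfolding X \<Phi>[OF H] using B P[OF H] iso
        by (intro equiv_class_eq[OF equiv]) (simp add: bundle_iso_rel_def)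
      then show "X \<in> \<Phi> ` (SIGMA H:R. Hom_classes \<Gamma> G H)"
        using mem[OF H] by (rule image_eqI)
    qed
  qed
  have unique: "\<exists>!c. c \<in> (SIGMA H:R. Hom_classes \<Gamma> G H) \<and> (\<exists>B\<in>\<Phi> c. bundle_isomorphic \<Gamma> G Q B)"
    if Q: "Q \<in> irreducible_bundles \<Gamma> G n" for Q :: "('a, 'b, 'p, 'z) principal_bundle"
  proof -
    obtain H \<rho> where H: "H \<in> R" "\<rho> \<in> Hom \<Gamma> G H"
      and iso: "bundle_isomorphic \<Gamma> G Q (?P H \<rho>)"
      using irreducible_isomorphic_assoc_bundle[OF assms(1,2) R Q] by blast
    have QP: "bundle_isomorphic \<Gamma> G (?P H \<rho>) Q"
      using Q iso equivariant_principal_bundle.bundle_isomorphic_sym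
      unfolding irreducible_bundles_def irreducible_bundle_def by blast
    show ?thesis
    proof (rule ex1I[of _ "(H, ?orbit H \<rho>)"])
      have "?P H \<rho> \<in> \<Phi> (H, ?orbit H \<rho>)"
        unfolding \<Phi>[OF H] by (rule equiv_class_self[OF equiv P[OF H]])
      then show "(H, ?orbit H \<rho>) \<in> (SIGMA H:R. Hom_classes \<Gamma> G H)
          \<and> (\<exists>B\<in>\<Phi> (H, ?orbit H \<rho>). bundle_isomorphic \<Gamma> G Q B)"
        using mem[OF H] iso by blast
    next
      fix c assume c: "c \<in> (SIGMA H:R. Hom_classes \<Gamma> G H)
          \<and> (\<exists>B\<in>\<Phi> c. bundle_isomorphic \<Gamma> G Q B)"
      then obtain K \<sigma> where K: "K \<in> R" "\<sigma> \<in> Hom \<Gamma> G K" "c = (K, ?orbit K \<sigma>)"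
        using cases by blast
      from c obtain B where "(?P K \<sigma>, B) \<in> ?r" and QB: "bundle_isomorphic \<Gamma> G Q B"
        unfolding K(3) \<Phi>[OF K(1,2)] by blast
      then have B: "bundle_isomorphic \<Gamma> G B (?P K \<sigma>)"
        by (intro sym[OF P[OF K(1,2)]]) (simp add: bundle_iso_rel_def)
      have "bundle_isomorphic \<Gamma> G (?P H \<rho>) (?P K \<sigma>)"
        using bundle_isomorphic_trans[OF bundle_isomorphic_trans[OF QP QB] B] .
      then show "c = (H, ?orbit H \<rho>)"
        unfolding K(3) by (intro same[symmetric] H K)
    qed
  qed
  show ?thesis
    by (intro exI[of _ \<Phi>] conjI ballI bij \<Phi> unique)
qed

end
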